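(* For every ordinal $\xi$ and every worm $A$, $o_{\xi+1}(A)=\ell\, o_\xi(A)$.
   Context: Formulas of the Reflection Calculus $\mathsf{RC}$ are given by $\phi ::= \top \mid \phi\wedge\psi \mid \alpha\phi$ with $\alpha$ any ordinal ($\alpha\phi$ is also written $\langle\alpha\rangle\phi$). We write $\phi\vdash\psi$ if this sequent is derivable from: $\phi\vdash\phi$; $\phi\vdash\top$; $\phi\wedge\psi\vdash\phi$; $\phi\wedge\psi\vdash\psi$; $\alpha\alpha\phi\vdash\alpha\phi$; $\beta\phi\vdash\alpha\phi$ and $\beta\phi\wedge\alpha\psi\vdash\beta(\phi\wedge\alpha\psi)$ for $\alpha<\beta$; with the rules: from $\phi\vdash\psi$ and $\psi\vdash\chi$ infer $\phi\vdash\chi$; from $\phi\vdash\psi$ and $\phi\vdash\chi$ infer $\phi\vdash\psi\wedge\chi$; from $\phi\vdash\psi$ infer $\alpha\phi\vdash\alpha\psi$. (The polymodal provability logic $\mathsf{GLP}$ is conservative over $\mathsf{RC}$, so equivalently $\mathsf{GLP}\vdash\phi\to\psi$.) Worms: $\mathbb W$ is the least class containing $\top$ and closed under $A\mapsto\langle\alpha\rangle A$ for each ordinal $\alpha$. $A<_\xi B$ iff $B\vdash\langle\xi\rangle A$. The relation $<_\xi$ is well-founded on $\mathbb W$, and $o_\xi(A):=\sup_{B<_\xi A}(o_\xi(B)+1)$ (with $\sup\varnothing=0$, $B$ ranging over $\mathbb W$). For an ordinal $\eta>0$, $\ell\eta$ is the unique $\beta$ such that $\eta=\alpha+\omega^\beta$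 for some ordinal $\alpha$; $\ell 0=0$. *)

theory Defs
  imports Main
begin

text \<open>
  HOL has no type of all ordinals.  The type \<open>'a ordinal\<close> consists of the order types of the
  well-orders whose field is a set of elements of \<open>'a + nat\<close>, that is, of the ordinals below the
  cardinal successor of the cardinality of \<open>'a + nat\<close>.  As \<open>'a\<close> is arbitrary, every ordinal is
  covered.  This initial segment is closed under suprema of families indexed by subsets of
  \<open>'a + nat\<close>, in particular under \<open>+\<close>, \<open>*\<close> and \<open>\<omega>^\<close>, see \<open>ordinal_bounded\<close> below.
\<close>

quotient_type (overloaded) 'a ordinal = "('a + nat) rel" / partial: "\<lambda>r s. (r, s) \<in> ordIso"
proof (rule part_equivpI)
  show "\<exists>r :: ('a + nat) rel. (r, r) \<in> ordIso"
    using card_of_refl by blast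
  show "symp (\<lambda>r s :: ('a + nat) rel. (r, s) \<in> ordIso)"
    by (auto intro: sympI ordIso_symmetric)
  show "transp (\<lambda>r s :: ('a + nat) rel. (r, s) \<in> ordIso)"
    by (auto intro: transpI ordIso_transitive)
qed

instantiation ordinal :: (type) wellorder
begin

lift_definition less_eq_ordinal :: "'a ordinal \<Rightarrow> 'a ordinal \<Rightarrow> bool" is "\<lambda>r s. (r, s) \<in> ordLeq"
  by (meson ordIso_ordLeq_trans ordIso_symmetric ordLeq_ordIso_trans)

lift_definition less_ordinal :: "'a ordinal \<Rightarrow> 'a ordinal \<Rightarrow> bool" is "\<lambda>r s. (r, s) \<in> ordLess"
  by (meson ordIso_ordLess_trans ordIso_symmetric ordLess_ordIso_trans)

instance
proof
  fix x y z :: "'a ordinal"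
  have WO: "Well_order r" if "(r, r) \<in> ordIso" for r :: "('a + nat) rel"
    using that by (simp add: ordIso_def)
  show "x < y \<longleftrightarrow> x \<le> y \<and> \<not> y \<le> x"
    by transfer (metis WO not_ordLeq_iff_ordLess ordLess_imp_ordLeq)
  show "x \<le> x"
    by transfer (simp add: ordIso_iff_ordLeq)
  show "x \<le> y \<Longrightarrow> y \<le> z \<Longrightarrow> x \<le> z"
    by transfer (rule ordLeq_transitive)
  show "x \<le> y \<Longrightarrow> y \<le> x \<Longrightarrow> x = y"
    by transfer (simp add: ordIso_iff_ordLeq)
  show "x \<le> y \<or> y \<le> x"
    by transfer (metis WO ordLeq_total)
next
  fix P and a :: "'a ordinal"
  assume step: "\<And>x :: 'a ordinal. (\<And>y. y < x \<Longrightarrow> P y) \<Longrightarrow> P x"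
  have "wf {(x, y :: 'a ordinal). x < y}"
  proof -
    have "{(x, y :: 'a ordinal). x < y} \<subseteq> inv_image ordLess rep_ordinal"
      by (auto simp: less_ordinal.rep_eq)
    then show ?thesis
      using wf_ordLess wf_inv_image wf_subset by blast
  qed
  then show "P a"
    by (rule wf_induct_rule) (use step in auto)
qed

end

definition otype :: "('a + nat) rel \<Rightarrow> 'a ordinal"
  where "otype = abs_ordinal"

lemma ordinal_cases: obtains r where "Well_order r" "x = otype r"
proof -
  have "(rep_ordinal x, rep_ordinal x) \<in> ordIso"
    using Quotient_rep_reflp[OF Quotient_ordinal] .
  moreover have "x = otype (rep_ordinal x)"
    using Quotient_abs_rep[OF Quotient_ordinal] unfolding otype_def by metis
  ultimately show thesis using that unfolding ordIso_def by blast
qed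

lemma otype_eq_iff:
  "Well_order r \<Longrightarrow> Well_order s \<Longrightarrow> otype r = otype s \<longleftrightarrow> (r, s) \<in> ordIso"
  using Quotient_rel[OF Quotient_ordinal, of r s] ordIso_reflexive[of r] ordIso_reflexive[of s]
  unfolding otype_def by blast

lemma otype_less_iff:
  "Well_order r \<Longrightarrow> Well_order s \<Longrightarrow> otype r < otype s \<longleftrightarrow> (r, s) \<in> ordLess"
  by (simp add: otype_def less_ordinal.abs_eq ordIso_reflexive)

lemma otype_less_Restr:
  assumes "Well_order r" "x < otype r"
  shows "\<exists>a \<in> Field r. x = otype (Restr r (underS r a))"
proof -
  obtain s where s: "Well_order s" "x = otype s" by (rule ordinal_cases)
  then have "(s, r) \<in> ordLess" using assms otype_less_iff by blast
  then obtain a where "a \<in> Field r" "(s, Restr r (underS r a)) \<in> ordIso"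
    using ordLess_iff_ordIso_Restr assms(1) s(1) by blast
  then show ?thesis using s assms(1) otype_eq_iff Well_order_Restr by blast
qed

lemma card_lessThan_ordinal: "(card_of {..< x :: 'a ordinal}, card_of (UNIV :: ('a + nat) set)) \<in> ordLeq"
proof -
  obtain r where r: "Well_order r" "x = otype r" by (rule ordinal_cases)
  then have "{..< x} \<subseteq> (\<lambda>a. otype (Restr r (underS r a))) ` UNIV"
    using otype_less_Restr by fastforce
  then show ?thesis
    by (rule surj_imp_ordLeq)
qed

lemma card_ordinal: "\<not> (card_of (UNIV :: 'a ordinal set), card_of (UNIV :: ('a + nat) set)) \<in> ordLeq"
proof
  assume "(card_of (UNIV :: 'a ordinal set), card_of (UNIV :: ('a + nat) set)) \<in> ordLeq"
  then obtain g :: "'a ordinal \<Rightarrow> 'a + nat" where g: "inj g"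
    using card_of_ordLeq[of "UNIV :: 'a ordinal set" "UNIV :: ('a + nat) set"] by auto
  define s where "s = {(g x, g y) | x y. x \<le> y}"
  have s_iff [simp]: "(g x, g y) \<in> s \<longleftrightarrow> x \<le> y" for x y
    using g by (auto simp: s_def inj_eq)
  have Field: "Field s = range g"
    unfolding s_def Field_def by auto
  have "wf (s - Id)"
  proof -
    have "s - Id \<subseteq> inv_image {(x, y :: 'a ordinal). x < y} (inv g)"
      using g by (auto simp: s_def)
    then show ?thesis using wf wf_inv_image wf_subset by blast
  qed
  then have s: "Well_order s"
    unfolding order_on_defs Field
    by (auto simp: refl_on_def trans_def antisym_def total_on_def s_def inj_eq[OF g])
  define F where "F x = otype (Restr s (underS s (g x)))" for x
  have under: "underS s (g x) = g ` {..< x}" for x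
    using g by (auto simp: underS_def s_def inj_eq)
  have F_mono: "F x < F y" if "x < y" for x y
  proof -
    let ?t = "Restr s (underS s (g y))"
    have t: "Well_order ?t" using s by (rule Well_order_Restr)
    have fld: "g x \<in> Field ?t" proof -
      have "(g x, g x) \<in> ?t" using that by (simp add: under)
      then show ?thesis unfolding Field_def by blast
    qed
    have "underS ?t (g x) = underS s (g x)"
      using that unfolding under by (auto simp: underS_def s_def inj_eq[OF g])
    moreover have "Restr ?t (underS s (g x)) = Restr s (underS s (g x))"
      using that unfolding under by auto
    moreover have "(Restr ?t (underS ?t (g x)), ?t) \<in> ordLess"
      using underS_Restr_ordLess t fld by fastforce
    ultimately show ?thesis
      unfolding F_def using otype_less_iff t s Well_order_Restr by metis
  qed
  have "x \<le> F x" for x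
  proof (induction x rule: less_induct)
    case (less x)
    show ?case
    proof (rule ccontr)
      assume "\<not> x \<le> F x"
      then have "F x < x" by simp
      then have "F x \<le> F (F x)" "F (F x) < F x" using less F_mono by auto
      then show False by simp
    qed
  qed
  moreover have "F (otype s) < otype s"
    using underS_Restr_ordLess[OF s] Field otype_less_iff s Well_order_Restr
    unfolding F_def by fastforce
  ultimately show False by (meson leD)
qed

lemma ordinal_bounded:
  fixes A :: "'a ordinal set"
  assumes "(card_of A, card_of (UNIV :: ('a + nat) set)) \<in> ordLeq"
  shows "\<exists>u. \<forall>x\<in>A. x < u"
proof (rule ccontr)
  assume "\<not> ?thesis"
  then have "\<exists>x\<in>A. u \<le> x" for u
    by (simp add: not_less)
  then have "UNIV = A \<union> (\<Union>x\<in>A. {..< x})"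
    by (auto simp: order_le_less)
  moreover have inf: "infinite (UNIV :: ('a + nat) set)"
    by (simp flip: UNIV_Plus_UNIV)
  have "(card_of (\<Union>x\<in>A. {..< x}), card_of (UNIV :: ('a + nat) set)) \<in> ordLeq"
    using card_of_UNION_ordLeq_infinite[OF inf assms] card_lessThan_ordinal by blast
  then have "(card_of (A \<union> (\<Union>x\<in>A. {..< x})), card_of (UNIV :: ('a + nat) set)) \<in> ordLeq"
    using card_of_Un_ordLeq_infinite_Field[OF _ assms _ card_of_Card_order] inf
    by (simp add: Field_card_of)
  ultimately show False using card_ordinal by metis
qed

definition osup :: "'a ordinal set \<Rightarrow> 'a ordinal"
  where "osup A = (LEAST u. \<forall>x\<in>A. x \<le> u)"

definition osuc :: "'a ordinal \<Rightarrow> 'a ordinal"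
  where "osuc a = (LEAST b. a < b)"

instantiation ordinal :: (type) "{zero, one, plus, times}"
begin

definition zero_ordinal :: "'a ordinal"
  where "0 = osup {}"

definition one_ordinal :: "'a ordinal"
  where "1 = osuc 0"

function plus_ordinal :: "'a ordinal \<Rightarrow> 'a ordinal \<Rightarrow> 'a ordinal"
  where "a + b = osup (insert a ((\<lambda>c. osuc (a + c)) ` {..< b}))"
  by auto
termination
  by (relation "inv_image {(x, y). x < y} snd") (auto simp: wf)

declare plus_ordinal.simps [simp del]

function times_ordinal :: "'a ordinal \<Rightarrow> 'a ordinal \<Rightarrow> 'a ordinal"
  where "a * b = osup ((\<lambda>c. a * c + a) ` {..< b})"
  by auto
termination
  by (relation "inv_image {(x, y). x < y} snd") (auto simp: wf)

declare times_ordinal.simps [simp del]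

instance ..

end

definition omega :: "'a ordinal"  (\<open>\<omega>\<close>)
  where "\<omega> = osup (range (\<lambda>n. (osuc ^^ n) 0))"

function omega_pow :: "'a ordinal \<Rightarrow> 'a ordinal"  (\<open>\<omega>^ _\<close> [81] 80)
  where "\<omega>^ b = osup (insert 1 ((\<lambda>c. \<omega>^ c * \<omega>) ` {..< b}))"
  by auto
termination
  by (relation "{(x, y). x < y}") (auto simp: wf)

declare omega_pow.simps [simp del]

definition ell :: "'a ordinal \<Rightarrow> 'a ordinal"  (\<open>\<ell>\<close>)
  where "\<ell> \<eta> = (if \<eta> = 0 then 0 else THE \<beta>. \<exists>\<alpha>. \<eta> = \<alpha> + \<omega>^ \<beta>)"

datatype 'a formula =
    Top  (\<open>\<top>\<close>)
  | Conj "'a formula" "'a formula"  (infixr \<open>\<^bold>\<and>\<close> 65)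
  | Dia "'a ordinal" "'a formula"  (\<open>\<langle>_\<rangle> _\<close> [0, 70] 70)

inductive rc :: "'a formula \<Rightarrow> 'a formula \<Rightarrow> bool"  (infix \<open>\<turnstile>\<close> 55) where
  rc_refl: "\<phi> \<turnstile> \<phi>"
| rc_top: "\<phi> \<turnstile> \<top>"
| rc_conj1: "\<phi> \<^bold>\<and> \<psi> \<turnstile> \<phi>"
| rc_conj2: "\<phi> \<^bold>\<and> \<psi> \<turnstile> \<psi>"
| rc_trans4: "\<langle>\<alpha>\<rangle> \<langle>\<alpha>\<rangle> \<phi> \<turnstile> \<langle>\<alpha>\<rangle> \<phi>"
| rc_mono: "\<alpha> < \<beta> \<Longrightarrow> \<langle>\<beta>\<rangle> \<phi> \<turnstile> \<langle>\<alpha>\<rangle> \<phi>"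
| rc_polytrans: "\<alpha> < \<beta> \<Longrightarrow> \<langle>\<beta>\<rangle> \<phi> \<^bold>\<and> \<langle>\<alpha>\<rangle> \<psi> \<turnstile> \<langle>\<beta>\<rangle> (\<phi> \<^bold>\<and> \<langle>\<alpha>\<rangle> \<psi>)"
| rc_cut: "\<phi> \<turnstile> \<psi> \<Longrightarrow> \<psi> \<turnstile> \<chi> \<Longrightarrow> \<phi> \<turnstile> \<chi>"
| rc_conjI: "\<phi> \<turnstile> \<psi> \<Longrightarrow> \<phi> \<turnstile> \<chi> \<Longrightarrow> \<phi> \<turnstile> \<psi> \<^bold>\<and> \<chi>"
| rc_nec: "\<phi> \<turnstile> \<psi> \<Longrightarrow> \<langle>\<alpha>\<rangle> \<phi> \<turnstile> \<langle>\<alpha>\<rangle> \<psi>"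

inductive_set worms :: "'a formula set" where
  "\<top> \<in> worms"
| "A \<in> worms \<Longrightarrow> \<langle>\<alpha>\<rangle> A \<in> worms"

definition worm_less :: "'a ordinal \<Rightarrow> 'a formula \<Rightarrow> 'a formula \<Rightarrow> bool"
  where "worm_less \<xi> A B \<longleftrightarrow> B \<turnstile> \<langle>\<xi>\<rangle> A"

text \<open>
  The recursion is along \<open>worm_less \<xi>\<close> restricted to worms.  All worms below a given worm \<open>A\<close> are
  built from modalities that do not exceed those of \<open>A\<close>, so the supremum ranges over a set
  to which \<open>ordinal_bounded\<close> applies, and its value does not depend on the choice of \<open>'a\<close>.
\<close>

definition worm_o :: "'a ordinal \<Rightarrow> 'a formula \<Rightarrow> 'a ordinal"
  where "worm_o \<xi> =
    wfrec {(B, A). B \<in> worms \<and> A \<in> worms \<and> worm_less \<xi> B A}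
      (\<lambda>f A. osup {f B + 1 | B. B \<in> worms \<and> worm_less \<xi> B A})"

end

theory Submission
  imports Defs
begin

text \<open>
  Sequents \<open>A \<turnstile> \<langle>\<xi>\<rangle> A\<close> are refuted in a model on ordinals in which the \<open>k\<close>-th modality
  compares the iterates \<open>\<ell>\<^sup>k\<close>; the axiom \<open>\<beta>\<phi> \<and> \<alpha>\<psi> \<turnstile> \<beta>(\<phi> \<and> \<alpha>\<psi>)\<close> holds there because
  of \<open>x + \<omega>^ b \<le> y\<close> for \<open>x < y\<close> and \<open>b \<le> \<ell> y\<close>.  Hence the worms with letters \<open>\<ge> \<xi>\<close> are
  strictly linearly ordered by \<open><\<^sub>\<xi>\<close> up to equivalence, and the comparison of two worms
  \<open>A \<xi> B\<close>, with all letters of \<open>A\<close> above \<open>\<xi>\<close>, reduces to that of their parts in the same way as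
  for a recursive path order, which yields well-foundedness.  It also mirrors the comparison of
  Cantor normal forms, so that \<open>o\<^sub>\<xi>(A \<xi> B) = o\<^sub>\<xi>(B) + \<omega>^ o\<^bsub>\<xi>+1\<^esub>(A)\<close>.  As
  \<open>o\<^bsub>\<xi>+1\<^esub>(A \<xi> B) = o\<^bsub>\<xi>+1\<^esub>(A)\<close>, the theorem follows.
\<close>

section \<open>Ordinal arithmetic\<close>

text \<open>\<open>osup\<close> is a \<open>LEAST\<close>, so it is a supremum only where an upper
  bound exists. Bounds come from cardinality, hence the size estimates throughout.\<close>

lemma bdd_above_small:
  fixes A :: "'a ordinal set"
  assumes "(card_of A, card_of (UNIV :: ('a + nat) set)) \<in> ordLeq"
  shows "bdd_above A"
  using ordinal_bounded[OF assms] by (meson bdd_above.I less_imp_le)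

lemma bdd_above_image_lessThan_ordinal: "bdd_above (f ` {..< b :: 'a ordinal} :: 'a ordinal set)"
  by (rule bdd_above_small) (rule ordLeq_transitive[OF card_of_image card_lessThan_ordinal])

lemma bdd_above_insert_ordinal: "bdd_above (insert (a :: 'a ordinal) A) \<longleftrightarrow> bdd_above A"
proof
  assume "bdd_above A"
  then obtain u where u: "\<forall>x\<in>A. x \<le> u" unfolding bdd_above_def by blast
  have "x \<le> max a u" if "x \<in> insert a A" for x
    using that u by (auto simp: le_max_iff_disj)
  then show "bdd_above (insert a A)" by (rule bdd_above.I)
qed (auto simp: bdd_above_def)

lemma infinite_plus_nat: "infinite (UNIV :: ('a + nat) set)"
  by (simp flip: UNIV_Plus_UNIV)

lemma nat_ordLeq_plus_nat:
  "(card_of (UNIV :: nat set), card_of (UNIV :: ('a + nat) set)) \<in> ordLeq"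
  using infinite_plus_nat infinite_iff_card_of_nat by blast

lemma bdd_above_range_nat_ordinal: "bdd_above (range f :: 'a ordinal set)" for f :: "nat \<Rightarrow> 'a ordinal"
  by (rule bdd_above_small) (rule ordLeq_transitive[OF card_of_image nat_ordLeq_plus_nat])

section \<open>Suprema and successors\<close>

lemma osup_least: "(\<And>x. x \<in> A \<Longrightarrow> x \<le> u) \<Longrightarrow> osup A \<le> u"
  unfolding osup_def by (rule Least_le) blast

lemma osup_upper:
  assumes "bdd_above A" "x \<in> A"
  shows "x \<le> osup A"
proof -
  have "\<forall>x\<in>A. x \<le> osup A"
    unfolding osup_def by (rule LeastI_ex) (use assms(1) in \<open>auto simp: bdd_above_def\<close>)
  then show ?thesis using assms(2) by blast
qed

lemma less_osup_iff: "bdd_above A \<Longrightarrow> y < osup A \<longleftrightarrow> (\<exists>x\<in>A. y < x)"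
  by (meson leD leI le_less_trans less_le_trans osup_least osup_upper)

lemma zero_le_ordinal [simp]: "0 \<le> (x :: 'a ordinal)"
  unfolding zero_ordinal_def by (rule osup_least) simp

lemma not_less_zero_ordinal [simp]: "\<not> x < (0 :: 'a ordinal)"
  by (simp add: not_less)

lemma zero_less_iff_ordinal: "0 < x \<longleftrightarrow> x \<noteq> (0 :: 'a ordinal)"
  by (metis zero_le_ordinal order_le_less not_less_zero_ordinal)

lemma less_osuc [simp]: "x < osuc x"
proof -
  have "\<exists>u. x < u"
  proof (rule ccontr)
    \<comment> \<open>A largest \<open>x\<close> would make the whole type as small as
      \<open>'a + nat\<close>, against \<open>card_ordinal\<close>.\<close>
    assume "\<not> (\<exists>u. x < u)"
    then have "UNIV = insert x {..< x}"
      by (auto simp: not_less order_le_less)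
    moreover have "(card_of (insert x {..< x}), card_of (UNIV :: ('a + nat) set)) \<in> ordLeq"
      using card_of_Un_ordLeq_infinite_Field[OF _ _ card_lessThan_ordinal card_of_Card_order, of "{x}"]
        infinite_plus_nat
      by (simp add: Field_card_of card_of_singl_ordLeq)
    ultimately show False using card_ordinal by metis
  qed
  then show ?thesis unfolding osuc_def by (rule LeastI_ex)
qed

lemma osuc_le_iff: "osuc x \<le> y \<longleftrightarrow> x < y"
  by (metis Least_le less_le_trans less_osuc osuc_def)

lemma less_osuc_iff: "y < osuc x \<longleftrightarrow> y \<le> x"
  by (meson leD leI osuc_le_iff)

lemma osup_le_iff: "bdd_above A \<Longrightarrow> osup A \<le> u \<longleftrightarrow> (\<forall>x\<in>A. x \<le> u)"
  by (meson leD leI less_osup_iff)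

text \<open>Because \<open>osuc (a + c) \<le> u\<close> means \<open>a + c < u\<close>, the
  recursive supremum becomes a family of bounds. This and its dual serve as the working definition
  of addition.\<close>

lemma plus_ordinal_le_iff: "a + b \<le> u \<longleftrightarrow> a \<le> u \<and> (\<forall>c<b. a + c < u)" for a :: "'a ordinal"
  by (subst plus_ordinal.simps)
     (auto simp: osup_le_iff bdd_above_insert_ordinal bdd_above_image_lessThan_ordinal osuc_le_iff)

lemma less_plus_ordinal_iff: "u < a + b \<longleftrightarrow> u < a \<or> (\<exists>c<b. u \<le> a + c)" for a :: "'a ordinal"
  using plus_ordinal_le_iff[of a b u] by (auto simp: not_le[symmetric])

lemma add_strict_left_mono_ordinal: "b < c \<Longrightarrow> a + b < a + c" for a :: "'a ordinal"
  by (auto simp: less_plus_ordinal_iff)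

lemma add_less_cancel_left_ordinal [simp]: "a + b < a + c \<longleftrightarrow> b < c" for a :: "'a ordinal"
  using add_strict_left_mono_ordinal[of b c a] add_strict_left_mono_ordinal[of c b a]
  by (cases b c rule: linorder_cases) auto

lemma add_le_cancel_left_ordinal [simp]: "a + b \<le> a + c \<longleftrightarrow> b \<le> c" for a :: "'a ordinal"
  by (simp flip: not_less)

lemma le_add_ordinal [simp]: "a \<le> a + b" for a :: "'a ordinal"
  using plus_ordinal_le_iff by blast

lemma add_right_mono_ordinal: "a \<le> a' \<Longrightarrow> a + b \<le> a' + b" for a :: "'a ordinal"
proof (induction b rule: less_induct)
  case (less b)
  have "a + c < a' + b" if "c < b" for c
    using less that by (meson add_strict_left_mono_ordinal le_less_trans)
  moreover have "a \<le> a' + b"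
    using less.prems by (meson le_add_ordinal order_trans)
  ultimately show ?case
    by (subst plus_ordinal_le_iff) blast
qed

lemma le_add_right_ordinal [simp]: "b \<le> a + b" for a :: "'a ordinal"
proof (induction b rule: less_induct)
  case (less b)
  show ?case
  proof (rule ccontr)
    assume "\<not> b \<le> a + b"
    then show False using less[of "a + b"] by (simp add: not_le)
  qed
qed

lemma le_imp_diff_ordinal:
  fixes a :: "'a ordinal"
  assumes "a \<le> b"
  obtains c where "b = a + c"
proof -
  \<comment> \<open>Every smaller \<open>c'\<close> has \<open>a + c' < b\<close>, which is what
    \<open>plus_ordinal_le_iff\<close> asks for in \<open>a + c \<le> b\<close>.\<close>
  define c where "c = (LEAST c. b \<le> a + c)"
  have "b \<le> a + c"
    unfolding c_def by (rule LeastI[of _ b]) simp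
  moreover have "a + c \<le> b"
    using assms not_less_Least[of _ "\<lambda>c. b \<le> a + c"]
    by (auto simp: plus_ordinal_le_iff c_def not_le)
  ultimately show thesis using that by force
qed

instance ordinal :: (type) monoid_add
proof
  fix a b c :: "'a ordinal"
  show "0 + a = a"
  proof (rule antisym)
    show "0 + a \<le> a"
    proof (induction a rule: less_induct)
      case (less a)
      then show ?case
        by (subst plus_ordinal_le_iff) (meson le_less_trans zero_le_ordinal)
    qed
  qed simp
  show "a + 0 = a"
    by (rule antisym) (simp_all add: plus_ordinal_le_iff[of a 0])
  show "a + b + c = a + (b + c)"
  proof (induction c rule: less_induct)
    case (less c)
    show ?case
    proof (rule antisym)
      show "a + b + c \<le> a + (b + c)"
        using less by (auto simp: plus_ordinal_le_iff[of "a + b"])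
      have "a + d < a + b + c" if "d < b + c" for d
      proof (cases "d < b")
        case True
        then show ?thesis by (meson add_strict_left_mono_ordinal le_add_ordinal less_le_trans)
      next
        case False
        then obtain e where "d = b + e" by (meson le_imp_diff_ordinal not_less)
        then show ?thesis using that less by (metis add_less_cancel_left_ordinal)
      qed
      then show "a + (b + c) \<le> a + b + c"
        by (meson le_add_ordinal order_trans plus_ordinal_le_iff)
    qed
  qed
qed

lemma plus_one_ordinal: "a + 1 = osuc a" for a :: "'a ordinal"
proof (rule antisym)
  have "c = 0" if "c < 1" for c :: "'a ordinal"
    using that by (metis antisym less_osuc_iff one_ordinal_def zero_le_ordinal)
  then show "a + 1 \<le> osuc a"
    unfolding plus_ordinal_le_iff by (metis add.right_neutral less_imp_le less_osuc)
  show "osuc a \<le> a + 1"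
    using add_strict_left_mono_ordinal[of 0 1 a] by (simp add: osuc_le_iff one_ordinal_def)
qed

lemma less_plus_one_ordinal_iff: "b < a + 1 \<longleftrightarrow> b \<le> a" for a :: "'a ordinal"
  by (simp add: plus_one_ordinal less_osuc_iff)

lemma plus_one_le_ordinal_iff: "a + 1 \<le> b \<longleftrightarrow> a < b" for a :: "'a ordinal"
  by (simp add: plus_one_ordinal osuc_le_iff)

lemma one_le_ordinal_iff: "1 \<le> a \<longleftrightarrow> 0 < a" for a :: "'a ordinal"
  by (simp add: one_ordinal_def osuc_le_iff)

lemma less_one_ordinal_iff: "a < 1 \<longleftrightarrow> a = 0" for a :: "'a ordinal"
  using zero_less_iff_ordinal[of a] one_le_ordinal_iff[of a] not_le[of 1 a] by blast

section \<open>Powers of omega\<close>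

lemma less_times_ordinal_iff: "u < a * b \<longleftrightarrow> (\<exists>c<b. u < a * c + a)" for a :: "'a ordinal"
  by (subst times_ordinal.simps) (simp add: less_osup_iff bdd_above_image_lessThan_ordinal Bex_def)

lemma le_if_less_imp_less: "(\<And>u. u < a \<Longrightarrow> u < b) \<Longrightarrow> a \<le> b" for a b :: "'b :: linorder"
  using not_less by blast

lemma times_ordinal_mono: "b \<le> c \<Longrightarrow> a * b \<le> a * c" for a :: "'a ordinal"
proof (rule le_if_less_imp_less)
  fix u
  assume "b \<le> c" "u < a * b"
  then show "u < a * c"
    unfolding less_times_ordinal_iff[of u] using less_le_trans by blast
qed

lemma times_zero_ordinal: "a * 0 = (0 :: 'a ordinal)"
  using less_times_ordinal_iff[of 0 a 0] zero_less_iff_ordinal[of "a * 0"] by simp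

lemma times_osuc_ordinal: "a * osuc b = a * b + a" for a :: "'a ordinal"
proof (rule antisym)
  have "u < a * b + a" if u: "u < a * osuc b" for u
  proof -
    obtain c where "c \<le> b" "u < a * c + a"
      using less_times_ordinal_iff[of u a "osuc b"] u by (auto simp: less_osuc_iff)
    moreover have "a * c + a \<le> a * b + a"
      using \<open>c \<le> b\<close> by (intro add_right_mono_ordinal times_ordinal_mono)
    ultimately show ?thesis by (metis less_le_trans)
  qed
  then show "a * osuc b \<le> a * b + a" by (rule le_if_less_imp_less)
  have "u < a * osuc b" if "u < a * b + a" for u
    by (rule less_times_ordinal_iff[THEN iffD2]) (use that less_osuc in blast)
  then show "a * b + a \<le> a * osuc b" by (rule le_if_less_imp_less)
qed

abbreviation onat :: "nat \<Rightarrow> 'a ordinal"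
  where "onat n \<equiv> (osuc ^^ n) 0"

lemma times_onat_add: "a * onat (m + n) = a * onat m + a * onat n" for a :: "'a ordinal"
proof (induction n)
  case 0
  then show ?case by (simp only: add_0_right funpow_0 times_zero_ordinal)
next
  case (Suc n)
  then show ?case
    by (simp only: add_Suc_right funpow.simps o_apply times_osuc_ordinal add.assoc)
qed

lemma less_omega_iff: "x < \<omega> \<longleftrightarrow> (\<exists>n. x < onat n)"
  by (auto simp: omega_def less_osup_iff bdd_above_range_nat_ordinal)

lemma less_times_omega_iff: "u < a * \<omega> \<longleftrightarrow> (\<exists>n. u < a * onat n)" for a :: "'a ordinal"
proof
  assume "u < a * \<omega>"
  then obtain c n where "c < onat n" "u < a * c + a"
    unfolding less_times_ordinal_iff[of u] less_omega_iff by blast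
  then have "u < a * onat n"
    unfolding less_times_ordinal_iff[of u] by blast
  then show "\<exists>n. u < a * onat n" ..
next
  assume "\<exists>n. u < a * onat n"
  then obtain n where "u < a * onat n" ..
  also have "a * onat n \<le> a * \<omega>"
    unfolding omega_def
    by (rule times_ordinal_mono, rule osup_upper) (simp_all add: bdd_above_range_nat_ordinal)
  finally show "u < a * \<omega>" .
qed

lemma less_omega_pow_iff: "u < \<omega>^ b \<longleftrightarrow> u = 0 \<or> (\<exists>c<b. u < \<omega>^ c * \<omega>)"
proof -
  have "u < \<omega>^ b \<longleftrightarrow> u < 1 \<or> (\<exists>c<b. u < \<omega>^ c * \<omega>)"
    by (subst omega_pow.simps)
       (auto simp: less_osup_iff bdd_above_insert_ordinal bdd_above_image_lessThan_ordinal)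
  then show ?thesis
    by (simp add: less_one_ordinal_iff)
qed

lemma omega_pow_pos [simp]: "0 < \<omega>^ b"
  by (simp add: less_omega_pow_iff)

lemma omega_pow_mono: "a \<le> b \<Longrightarrow> \<omega>^ a \<le> \<omega>^ b"
  by (rule le_if_less_imp_less) (auto simp: less_omega_pow_iff[of _ a] less_omega_pow_iff[of _ b])

text \<open>Both summands lie below finite multiples of one common smaller power
  \<open>\<omega>^ e\<close>, and finite multiples add up.\<close>

lemma omega_pow_add_closed:
  assumes "x < \<omega>^ a" "y < \<omega>^ a"
  shows "x + y < \<omega>^ a"
proof (cases "x = 0 \<or> y = 0")
  case False
  then obtain c d m n where cd: "c < a" "d < a" "x < \<omega>^ c * onat m" "y < \<omega>^ d * onat n"
    using assms by (auto simp: less_omega_pow_iff[of _ a] less_times_omega_iff)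
  define e where "e = max c d"
  have mono: "u * onat k \<le> v * onat k" if "u \<le> v" for u v :: "'a ordinal" and k
    using that
    by (induction k)
       (auto simp: times_osuc_ordinal times_zero_ordinal intro: order_trans add_right_mono_ordinal)
  have "x < \<omega>^ e * onat m" "y < \<omega>^ e * onat n"
    using cd mono[OF omega_pow_mono] unfolding e_def by (meson less_le_trans max.cobounded1 max.cobounded2)+
  then have "x + y < \<omega>^ e * onat m + \<omega>^ e * onat n"
    by (meson add_right_mono_ordinal add_strict_left_mono_ordinal less_imp_le less_le_trans)
  then have "x + y < \<omega>^ e * \<omega>"
    using less_times_omega_iff times_onat_add by metis
  moreover have "e < a" using cd by (simp add: e_def)
  ultimately show ?thesis using less_omega_pow_iff by blast
qed (use assms in auto)

lemma omega_pow_strict_mono: "a < b \<Longrightarrow> \<omega>^ a < \<omega>^ b"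
proof -
  have "\<omega>^ a < \<omega>^ a * onat 2"
    using add_strict_left_mono_ordinal[of 0 "\<omega>^ a" "\<omega>^ a"]
    by (simp add: numeral_2_eq_2 times_osuc_ordinal times_zero_ordinal)
  then show "\<omega>^ a < \<omega>^ b" if "a < b"
    using that less_omega_pow_iff less_times_omega_iff by blast
qed

lemma le_omega_pow: "a \<le> \<omega>^ a"
proof (induction a rule: less_induct)
  case (less a)
  show ?case
  proof (rule le_if_less_imp_less)
    fix u
    assume "u < a"
    then show "u < \<omega>^ a"
      using less omega_pow_strict_mono le_less_trans by blast
  qed
qed

lemma omega_pow_absorb: "x < \<omega>^ a \<Longrightarrow> x + \<omega>^ a = \<omega>^ a"
  by (rule antisym) (auto simp: plus_ordinal_le_iff omega_pow_add_closed intro: less_imp_le)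

text \<open>If \<open>x\<close> exceeds \<open>y\<close>, it is \<open>y + z\<close> with
  \<open>z < \<omega>^ a\<close>, and the ordinals below \<open>\<omega>^ a\<close> are closed under
  addition.\<close>

lemma less_add_omega_pow:
  assumes "x < y + \<omega>^ a" "b < a"
  shows "x + \<omega>^ b < y + \<omega>^ a"
proof (cases "x \<le> y")
  case True
  then show ?thesis
    by (meson assms(2) add_right_mono_ordinal add_strict_left_mono_ordinal le_less_trans omega_pow_strict_mono)
next
  case False
  then obtain z where "x = y + z" by (meson le_imp_diff_ordinal linear)
  then show ?thesis
    using assms by (simp add: add.assoc omega_pow_add_closed omega_pow_strict_mono)
qed

lemma add_omega_pow_le:
  assumes "x < y + \<omega>^ a" "b \<le> a"
  shows "x + \<omega>^ b \<le> y + \<omega>^ a"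
proof (cases "b = a \<and> y < x")
  case True
  then obtain z where "x = y + z" by (meson le_imp_diff_ordinal less_imp_le)
  then show ?thesis
    using assms True by (simp add: add.assoc omega_pow_absorb)
next
  case False
  then show ?thesis
    using assms less_add_omega_pow[of x y a b]
    by (metis add_right_mono_ordinal not_less order_le_less)
qed

text \<open>The last term of the Cantor normal form, reached without the full expansion: the least
  nonzero right remainder of \<open>r\<close> cannot be decomposed further, which forces it to be a
  power of omega.\<close>

lemma omega_pow_last_summand:
  fixes r :: "'a ordinal"
  assumes "0 < r"
  obtains s d where "r = s + \<omega>^ d"
proof -
  define P where "P t \<longleftrightarrow> 0 < t \<and> (\<exists>s. r = s + t)" for t
  define t where "t = (LEAST t. P t)"
  have "P r" using assms unfolding P_def by (metis add.left_neutral)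
  then have "P t" unfolding t_def by (rule LeastI)
  then obtain s where s: "r = s + t" "0 < t" unfolding P_def by blast
  have absorb: "y = t" if "t = x + y" "y \<noteq> 0" for x y
  proof (rule antisym)
    show "y \<le> t" using that by simp
    have "P y"
      unfolding P_def using that s zero_less_iff_ordinal by (metis add.assoc)
    then show "t \<le> y" unfolding t_def by (rule Least_le)
  qed
  \<comment> \<open>Minimality of \<open>e\<close> will place \<open>t\<close> between some
    \<open>\<omega>^ c\<close> and a finite multiple of it.\<close>
  define e where "e = (LEAST e. t < \<omega>^ e)"
  have "t < \<omega>^ (t + 1)"
    by (meson le_omega_pow less_le_trans less_plus_one_ordinal_iff order_refl)
  then have "t < \<omega>^ e" unfolding e_def by (rule LeastI)
  then obtain c n where c: "c < e" "t < \<omega>^ c * onat n"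
    using s less_omega_pow_iff less_times_omega_iff zero_less_iff_ordinal by metis
  have "\<omega>^ c \<le> t"
    using c(1) not_less_Least[of c "\<lambda>e. t < \<omega>^ e"] unfolding e_def by (simp add: not_less)
  then obtain y where y: "t = \<omega>^ c + y" by (rule le_imp_diff_ordinal)
  have "y = 0"
  proof (rule ccontr)
    assume "y \<noteq> 0"
    \<comment> \<open>A nonzero \<open>y\<close> equals \<open>t\<close>, so \<open>t\<close>
      absorbs \<open>\<omega>^ c\<close> on its left and dominates all finite multiples of
      it.\<close>
    then have t: "t = \<omega>^ c + t" using y absorb[OF y] by metis
    have "\<omega>^ c * onat n \<le> t" for n
    proof (induction n)
      case (Suc n)
      have "\<omega>^ c * onat (Suc n) = \<omega>^ c * onat 1 + \<omega>^ c * onat n"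
        using times_onat_add[of "\<omega>^ c" 1 n] by simp
      also have "\<dots> = \<omega>^ c + \<omega>^ c * onat n"
        by (simp add: times_osuc_ordinal times_zero_ordinal)
      also have "\<dots> \<le> t" using Suc t by (metis add_le_cancel_left_ordinal)
      finally show ?case .
    qed (simp add: times_zero_ordinal)
    then show False using c(2) not_less by blast
  qed
  then show thesis using that s y by simp
qed

text \<open>Provides the lower bound on order types in \<open>order_type_append\<close>. If it
  failed, \<open>m\<close> would be \<open>x + s + \<omega>^ d\<close> with \<open>d < a\<close>,
  and closure at \<open>x + s\<close> would put \<open>m\<close> below itself.\<close>

lemma add_omega_pow_le_if_closed:
  fixes x m a :: "'a ordinal"
  assumes "x < m" and closed: "\<And>y d. y < m \<Longrightarrow> d < a \<Longrightarrow> y + \<omega>^ d < m"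
  shows "x + \<omega>^ a \<le> m"
proof (rule ccontr)
  assume less: "\<not> x + \<omega>^ a \<le> m"
  obtain r where r: "m = x + r" using assms(1) by (meson le_imp_diff_ordinal less_imp_le)
  then have "0 < r" using assms(1) zero_less_iff_ordinal by fastforce
  then obtain s d where sd: "r = s + \<omega>^ d" by (rule omega_pow_last_summand)
  have "\<omega>^ d \<le> r" using sd by simp
  also have "r < \<omega>^ a" using less r by (simp add: not_le)
  finally have "d < a" by (metis not_less omega_pow_mono)
  moreover have "x + s < m"
    using r sd add_strict_left_mono_ordinal[of 0 "\<omega>^ d" s] by simp
  ultimately show False using closed[of "x + s" d] r sd by (simp add: add.assoc)
qed

section \<open>The last exponent\<close>

lemma ell_zero [simp]: "\<ell> 0 = 0"
  by (simp add: ell_def)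

text \<open>Makes the description in \<open>\<ell>\<close> unique. For \<open>a < b\<close>,
  \<open>less_add_omega_pow\<close> would make the left side strictly smaller.\<close>

lemma add_omega_pow_inj: "x + \<omega>^ a = y + \<omega>^ b \<Longrightarrow> a = b"
  by (metis add.right_neutral add_less_cancel_left_ordinal less_add_omega_pow less_irrefl linorder_neqE omega_pow_pos)

lemma ell_add_omega_pow [simp]: "\<ell> (x + \<omega>^ a) = a"
proof -
  have "0 < x + \<omega>^ a" by (meson le_add_right_ordinal less_le_trans omega_pow_pos)
  then show ?thesis
    unfolding ell_def by (auto intro!: the_equality dest: add_omega_pow_inj)
qed

text \<open>The frame conditions rest on this: \<open>y\<close> ends in the power with exponent
  \<open>\<ell> y\<close>, and a power with no larger exponent cannot lead past it.\<close>

lemma add_omega_pow_le_of_ell: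
  assumes "x < y" "b \<le> \<ell> y"
  shows "x + \<omega>^ b \<le> y"
proof -
  have "0 < y" using assms(1) by (meson le_less_trans zero_le_ordinal)
  then obtain s d where "y = s + \<omega>^ d" by (rule omega_pow_last_summand)
  then show ?thesis using assms add_omega_pow_le by simp
qed

section \<open>Irreflexivity\<close>

text \<open>The relation \<open>iter_ell_less k\<close> interprets the \<open>k\<close>-th modality, for natural numbers \<open>k\<close>.\<close>

definition iter_ell_less :: "nat \<Rightarrow> 'a ordinal \<Rightarrow> 'a ordinal \<Rightarrow> bool"
  where "iter_ell_less k b a \<longleftrightarrow> (\<forall>j<k. (\<ell> ^^ j) b \<le> (\<ell> ^^ j) a) \<and> (\<ell> ^^ k) b < (\<ell> ^^ k) a"

lemma iter_ell_less_trans: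
  "iter_ell_less k c b \<Longrightarrow> iter_ell_less k b a \<Longrightarrow> iter_ell_less k c a"
  unfolding iter_ell_less_def by (meson less_trans order_trans)

lemma iter_ell_add: "(\<ell> ^^ (m + n)) x = (\<ell> ^^ m) ((\<ell> ^^ n) x)"
  by (simp add: funpow_add)

text \<open>Equal \<open>j\<close>-th iterates would force equal \<open>k\<close>-th ones, so the
  weak inequality at \<open>j\<close> is strict. This validates \<open>rc_mono\<close>.\<close>

lemma iter_ell_less_antimono:
  assumes "iter_ell_less k b a" "j < k"
  shows "iter_ell_less j b a"
proof -
  have "(\<ell> ^^ j) b \<noteq> (\<ell> ^^ j) a"
    using assms iter_ell_add[of "k - j" j] unfolding iter_ell_less_def
    by (metis add_diff_cancel_right' le_add_diff_inverse2 less_imp_le_nat less_irrefl)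
  then show ?thesis
    using assms unfolding iter_ell_less_def by (meson less_trans order_le_neq_trans)
qed

text \<open>The witness is \<open>x + \<omega>^ d\<close>, unless \<open>x = a\<close>, where the
  bounds pin \<open>\<ell> a\<close> to \<open>d\<close>.\<close>

lemma ell_intermediate:
  assumes "x \<le> a" "\<ell> x \<le> d" "d \<le> \<ell> a"
  shows "\<exists>y. x \<le> y \<and> y \<le> a \<and> \<ell> y = d"
proof (cases "x = a")
  case True
  then show ?thesis using assms by (metis antisym order_refl)
next
  case False
  then have "x + \<omega>^ d \<le> a" using assms by (intro add_omega_pow_le_of_ell) simp_all
  then show ?thesis using ell_add_omega_pow le_add_ordinal by blast
qed

lemma iter_ell_intermediate:
  assumes "\<forall>i<n. (\<ell> ^^ i) b \<le> (\<ell> ^^ i) a" "\<forall>i<n. (\<ell> ^^ i) c \<le> (\<ell> ^^ i) a"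
    and "(\<ell> ^^ n) b \<le> d" "(\<ell> ^^ n) c \<le> d" "d \<le> (\<ell> ^^ n) a"
  shows "\<exists>x. (\<ell> ^^ n) x = d \<and>
    (\<forall>i<n. (\<ell> ^^ i) b \<le> (\<ell> ^^ i) x \<and> (\<ell> ^^ i) c \<le> (\<ell> ^^ i) x \<and> (\<ell> ^^ i) x \<le> (\<ell> ^^ i) a)"
  using assms
proof (induction n arbitrary: d)
  case (Suc n)
  \<comment> \<open>\<open>d\<close> is lifted through one \<ell>, starting above the larger of the
    two lower bounds so that both \<open>b\<close> and \<open>c\<close> stay dominated.\<close>
  let ?m = "max ((\<ell> ^^ n) b) ((\<ell> ^^ n) c)"
  have "?m \<le> (\<ell> ^^ n) a" "\<ell> ?m \<le> d" "d \<le> \<ell> ((\<ell> ^^ n) a)"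
    using Suc.prems by (auto simp: max_def)
  then obtain y where y: "?m \<le> y" "y \<le> (\<ell> ^^ n) a" "\<ell> y = d"
    using ell_intermediate by blast
  then obtain x where "(\<ell> ^^ n) x = y"
    "\<forall>i<n. (\<ell> ^^ i) b \<le> (\<ell> ^^ i) x \<and> (\<ell> ^^ i) c \<le> (\<ell> ^^ i) x \<and> (\<ell> ^^ i) x \<le> (\<ell> ^^ i) a"
    using Suc.IH[of y] Suc.prems by auto
  then show ?case
    using y by (intro exI[of _ x]) (auto simp: less_Suc_eq)
qed simp

text \<open>Frame condition for \<open>rc_polytrans\<close>. The point \<open>b\<close> need not see
  \<open>c\<close>, so it is replaced by an \<open>x\<close> that does and that dominates
  \<open>b\<close> in every iterate; \<open>truth_upward_closed\<close> then transfers truth from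
  \<open>b\<close> to \<open>x\<close>.\<close>

lemma iter_ell_less_polytrans:
  assumes b: "iter_ell_less k b a" and c: "iter_ell_less j c a" and "j < k"
  shows "\<exists>x. iter_ell_less k x a \<and> iter_ell_less j c x \<and> (\<forall>i. (\<ell> ^^ i) b \<le> (\<ell> ^^ i) x)"
proof -
  have le: "(\<ell> ^^ i) b \<le> (\<ell> ^^ i) a" if "i \<le> k" for i
    using that b unfolding iter_ell_less_def by (metis le_neq_implies_less less_imp_le)
  \<comment> \<open>\<open>d\<close> will be the \<open>j\<close>-th iterate of \<open>x\<close>: it
    must exceed that of \<open>c\<close> but have the same \<ell> as that of \<open>b\<close>, so
    that later iterates agree with those of \<open>b\<close>.\<close>
  have "\<exists>d. (\<ell> ^^ j) b \<le> d \<and> d \<le> (\<ell> ^^ j) a \<and> (\<ell> ^^ j) c < d \<and> \<ell> d = \<ell> ((\<ell> ^^ j) b)"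
  proof (cases "(\<ell> ^^ j) c < (\<ell> ^^ j) b")
    case True
    then show ?thesis using le \<open>j < k\<close> by auto
  next
    case False
    let ?d = "(\<ell> ^^ j) c + \<omega>^ \<ell> ((\<ell> ^^ j) b)"
    have "?d \<le> (\<ell> ^^ j) a"
      using c le[of "Suc j"] \<open>j < k\<close> by (intro add_omega_pow_le_of_ell) (auto simp: iter_ell_less_def)
    moreover have "(\<ell> ^^ j) c < ?d"
      using add_strict_left_mono_ordinal[OF omega_pow_pos] by (metis add.right_neutral)
    ultimately show ?thesis
      using False by (intro exI[of _ ?d]) auto
  qed
  then obtain d where d: "(\<ell> ^^ j) b \<le> d" "d \<le> (\<ell> ^^ j) a" "(\<ell> ^^ j) c < d" "\<ell> d = \<ell> ((\<ell> ^^ j) b)"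
    by blast
  then obtain x where x: "(\<ell> ^^ j) x = d" "\<forall>i<j. (\<ell> ^^ i) b \<le> (\<ell> ^^ i) x \<and>
      (\<ell> ^^ i) c \<le> (\<ell> ^^ i) x \<and> (\<ell> ^^ i) x \<le> (\<ell> ^^ i) a"
    using iter_ell_intermediate[of j b a c d] c le \<open>j < k\<close> less_imp_le[OF d(3)] unfolding iter_ell_less_def by auto
  have above: "(\<ell> ^^ i) x = (\<ell> ^^ i) b" if "j < i" for i
  proof -
    have "i = (i - Suc j) + Suc j" using that by simp
    then have "(\<ell> ^^ i) y = (\<ell> ^^ (i - Suc j)) (\<ell> ((\<ell> ^^ j) y))" for y :: "'a ordinal"
      using iter_ell_add[of "i - Suc j" "Suc j" y] by simp
    then show ?thesis using x(1) d(4) by simp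
  qed
  have ge: "(\<ell> ^^ i) b \<le> (\<ell> ^^ i) x" for i
    using x d(1) above by (cases i j rule: linorder_cases) auto
  have "(\<ell> ^^ i) x \<le> (\<ell> ^^ i) a" if "i < k" for i
    using x d(2) above le that by (cases i j rule: linorder_cases) auto
  then have "iter_ell_less k x a"
    using b above[OF \<open>j < k\<close>] by (simp add: iter_ell_less_def)
  moreover have "iter_ell_less j c x"
    using x d(3) by (simp add: iter_ell_less_def)
  ultimately show ?thesis using ge by blast
qed

text \<open>With no bound from above, \<open>(\<ell> ^^ n) b + \<omega>^ d\<close> serves at each
  level as a preimage of \<open>d\<close> under \<ell>.\<close>

lemma iter_ell_unbounded:
  "(\<ell> ^^ n) b \<le> d \<Longrightarrow> \<exists>x. (\<ell> ^^ n) x = d \<and> (\<forall>i<n. (\<ell> ^^ i) b \<le> (\<ell> ^^ i) x)"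
proof (induction n arbitrary: d)
  case (Suc n)
  obtain x where "(\<ell> ^^ n) x = (\<ell> ^^ n) b + \<omega>^ d" "\<forall>i<n. (\<ell> ^^ i) b \<le> (\<ell> ^^ i) x"
    using Suc.IH[OF le_add_ordinal] by blast
  then show ?case by (intro exI[of _ x]) (auto simp: less_Suc_eq)
qed simp

lemma iter_ell_less_unbounded: "\<exists>a. iter_ell_less k b a"
proof -
  obtain x where "(\<ell> ^^ k) x = (\<ell> ^^ k) b + 1" "\<forall>i<k. (\<ell> ^^ i) b \<le> (\<ell> ^^ i) x"
    using iter_ell_unbounded[OF le_add_ordinal] by blast
  then show ?thesis
    unfolding iter_ell_less_def by (metis less_plus_one_ordinal_iff order_refl)
qed

text \<open>
  A derivation involves finitely many modalities, so the ordinals in \<open>\<langle>\<alpha>\<rangle>\<close> can be replaced by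
  natural numbers, namely by their positions in a large enough finite set \<open>T\<close>.
\<close>

definition position :: "'a ordinal set \<Rightarrow> 'a ordinal \<Rightarrow> nat"
  where "position T \<alpha> = card {\<beta> \<in> T. \<beta> < \<alpha>}"

lemma position_less:
  assumes "finite T" "\<alpha> \<in> T" "\<alpha> < \<beta>"
  shows "position T \<alpha> < position T \<beta>"
  unfolding position_def using assms by (intro psubset_card_mono) auto

section \<open>Truth in the ordinal model\<close>

primrec truth :: "'a ordinal set \<Rightarrow> 'a formula \<Rightarrow> 'a ordinal set"
  where
    "truth T \<top> = UNIV"
  | "truth T (\<phi> \<^bold>\<and> \<psi>) = truth T \<phi> \<inter> truth T \<psi>"
  | "truth T (\<langle>\<alpha>\<rangle> \<phi>) = {a. \<exists>b\<in>truth T \<phi>. iter_ell_less (position T \<alpha>) b a}"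

lemma truth_upward_closed:
  "b \<in> truth T \<phi> \<Longrightarrow> \<forall>i. (\<ell> ^^ i) b \<le> (\<ell> ^^ i) a \<Longrightarrow> a \<in> truth T \<phi>"
  by (induction \<phi>) (auto simp: iter_ell_less_def, meson less_le_trans order_trans)

text \<open>Only \<open>rc_mono\<close> and \<open>rc_polytrans\<close> compare two modalities; each
  puts its smaller letter into \<open>S\<close>. Quantifying over all larger \<open>T\<close> lets
  the sets of two premises be united.\<close>

lemma truth_sound: "\<phi> \<turnstile> \<psi> \<Longrightarrow> \<exists>S. finite S \<and> (\<forall>T. finite T \<longrightarrow> S \<subseteq> T \<longrightarrow> truth T \<phi> \<subseteq> truth T \<psi>)"
proof (induction rule: rc.induct)
  case (rc_trans4 \<alpha> \<phi>)
  have "truth T (\<langle>\<alpha>\<rangle> \<langle>\<alpha>\<rangle> \<phi>) \<subseteq> truth T (\<langle>\<alpha>\<rangle> \<phi>)" for T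
    by simp (blast intro: iter_ell_less_trans)
  then show ?case by (intro exI[of _ "{}"]) simp
next
  case (rc_mono \<alpha> \<beta> \<phi>)
  have "truth T (\<langle>\<beta>\<rangle> \<phi>) \<subseteq> truth T (\<langle>\<alpha>\<rangle> \<phi>)" if "finite T" "\<alpha> \<in> T" for T
    using iter_ell_less_antimono[OF _ position_less[OF that rc_mono]] by auto
  then show ?case by (intro exI[of _ "{\<alpha>}"]) simp
next
  case (rc_polytrans \<alpha> \<beta> \<phi> \<psi>)
  have "truth T (\<langle>\<beta>\<rangle> \<phi> \<^bold>\<and> \<langle>\<alpha>\<rangle> \<psi>) \<subseteq> truth T (\<langle>\<beta>\<rangle> (\<phi> \<^bold>\<and> \<langle>\<alpha>\<rangle> \<psi>))" if T: "finite T" "\<alpha> \<in> T" for T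
  proof
    fix a assume "a \<in> truth T (\<langle>\<beta>\<rangle> \<phi> \<^bold>\<and> \<langle>\<alpha>\<rangle> \<psi>)"
    then obtain b c where b: "b \<in> truth T \<phi>" "iter_ell_less (position T \<beta>) b a"
      and c: "c \<in> truth T \<psi>" "iter_ell_less (position T \<alpha>) c a"
      by auto
    then obtain x where "iter_ell_less (position T \<beta>) x a" "iter_ell_less (position T \<alpha>) c x"
      and "\<forall>i. (\<ell> ^^ i) b \<le> (\<ell> ^^ i) x"
      using iter_ell_less_polytrans[OF _ _ position_less[OF T rc_polytrans]] by blast
    then show "a \<in> truth T (\<langle>\<beta>\<rangle> (\<phi> \<^bold>\<and> \<langle>\<alpha>\<rangle> \<psi>))"
      using c truth_upward_closed[OF b(1), of x] by auto
  qed
  then show ?case by (intro exI[of _ "{\<alpha>}"]) simp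
next
  case (rc_cut \<phi> \<psi> \<chi>)
  obtain S where S: "finite S" "\<And>T. finite T \<Longrightarrow> S \<subseteq> T \<Longrightarrow> truth T \<phi> \<subseteq> truth T \<psi>"
    using rc_cut.IH(1) by blast
  obtain S' where S': "finite S'" "\<And>T. finite T \<Longrightarrow> S' \<subseteq> T \<Longrightarrow> truth T \<psi> \<subseteq> truth T \<chi>"
    using rc_cut.IH(2) by blast
  have "truth T \<phi> \<subseteq> truth T \<chi>" if "finite T" "S \<union> S' \<subseteq> T" for T
    using S(2)[of T] S'(2)[of T] that by simp
  then show ?case using S(1) S'(1) by (intro exI[of _ "S \<union> S'"]) simp
next
  case (rc_conjI \<phi> \<psi> \<chi>)
  obtain S where S: "finite S" "\<And>T. finite T \<Longrightarrow> S \<subseteq> T \<Longrightarrow> truth T \<phi> \<subseteq> truth T \<psi>"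
    using rc_conjI.IH(1) by blast
  obtain S' where S': "finite S'" "\<And>T. finite T \<Longrightarrow> S' \<subseteq> T \<Longrightarrow> truth T \<phi> \<subseteq> truth T \<chi>"
    using rc_conjI.IH(2) by blast
  have "truth T \<phi> \<subseteq> truth T (\<psi> \<^bold>\<and> \<chi>)" if "finite T" "S \<union> S' \<subseteq> T" for T
    using S(2)[of T] S'(2)[of T] that by simp
  then show ?case using S(1) S'(1) by (intro exI[of _ "S \<union> S'"]) simp
next
  case (rc_nec \<phi> \<psi> \<alpha>)
  obtain S where S: "finite S" "\<And>T. finite T \<Longrightarrow> S \<subseteq> T \<Longrightarrow> truth T \<phi> \<subseteq> truth T \<psi>"
    using rc_nec.IH by blast
  have "truth T (\<langle>\<alpha>\<rangle> \<phi>) \<subseteq> truth T (\<langle>\<alpha>\<rangle> \<psi>)" if "finite T" "S \<subseteq> T" for T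
    using S(2)[OF that] by auto
  then show ?case using S(1) by blast
qed (auto intro!: exI[of _ "{}"])

lemma truth_worm_nonempty: "A \<in> worms \<Longrightarrow> truth T A \<noteq> {}"
proof (induction rule: worms.induct)
  case (2 A \<alpha>)
  then show ?case using iter_ell_less_unbounded by fastforce
qed simp

lemma worm_irreflexive:
  assumes "A \<in> worms"
  shows "\<not> A \<turnstile> \<langle>\<xi>\<rangle> A"
proof
  assume "A \<turnstile> \<langle>\<xi>\<rangle> A"
  from truth_sound[OF this] obtain T where T: "truth T A \<subseteq> truth T (\<langle>\<xi>\<rangle> A)"
    by blast
  let ?l = "\<ell> ^^ position T \<xi>"
  \<comment> \<open>At a point of \<open>truth T A\<close> with the least value of this iterate,
    \<open>\<langle>\<xi>\<rangle> A\<close> would yield another point of \<open>truth T A\<close>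
    with a smaller value.\<close>
  define m where "m = (LEAST x. x \<in> ?l ` truth T A)"
  have "m \<in> ?l ` truth T A"
    unfolding m_def by (rule LeastI_ex) (use truth_worm_nonempty[OF assms] in blast)
  then obtain b where b: "b \<in> truth T A" "m = ?l b" by blast
  then obtain c where "c \<in> truth T A" "?l c < m"
    using T by (auto simp: iter_ell_less_def)
  then show False
    using not_less_Least[of "?l c" "\<lambda>x. x \<in> ?l ` truth T A"] by (simp add: m_def)
qed

section \<open>Worms as words\<close>

primrec worm :: "'a ordinal list \<Rightarrow> 'a formula"
  where
    "worm [] = \<top>"
  | "worm (\<alpha> # xs) = \<langle>\<alpha>\<rangle> worm xs"

lemma worm_in_worms [simp]: "worm xs \<in> worms"
  by (induction xs) (auto intro: worms.intros)

lemma worms_eq_range: "worms = range worm"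
proof -
  have "A \<in> range worm" if "A \<in> worms" for A :: "'a formula"
    using that
  proof induction
    case 1
    show ?case by (rule range_eqI[of _ _ "[]"]) simp
  next
    case (2 A \<alpha>)
    then obtain xs where "A = worm xs" by blast
    then show ?case by (intro range_eqI[of _ _ "\<alpha> # xs"]) simp
  qed
  then show ?thesis by auto
qed

lemma not_worm_less_self: "\<not> worm xs \<turnstile> \<langle>\<xi>\<rangle> worm xs"
  by (simp add: worm_irreflexive)

section \<open>Derived rules\<close>

lemma dia_antimono: "\<phi> \<turnstile> \<langle>\<beta>\<rangle> \<psi> \<Longrightarrow> \<alpha> \<le> \<beta> \<Longrightarrow> \<phi> \<turnstile> \<langle>\<alpha>\<rangle> \<psi>"
  by (metis order_le_less rc_cut rc_mono)

lemma dia_trans: "\<phi> \<turnstile> \<langle>\<alpha>\<rangle> \<psi> \<Longrightarrow> \<psi> \<turnstile> \<langle>\<alpha>\<rangle> \<chi> \<Longrightarrow> \<phi> \<turnstile> \<langle>\<alpha>\<rangle> \<chi>"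
  by (meson rc_cut rc_nec rc_trans4)

lemma dia_cut: "\<phi> \<turnstile> \<langle>\<alpha>\<rangle> \<psi> \<Longrightarrow> \<psi> \<turnstile> \<chi> \<Longrightarrow> \<phi> \<turnstile> \<langle>\<alpha>\<rangle> \<chi>"
  by (meson rc_cut rc_nec)

lemma dia_conjI:
  assumes "\<phi> \<turnstile> \<langle>\<beta>\<rangle> \<psi>" "\<phi> \<turnstile> \<langle>\<alpha>\<rangle> \<chi>" "\<alpha> < \<beta>"
  shows "\<phi> \<turnstile> \<langle>\<beta>\<rangle> (\<psi> \<^bold>\<and> \<langle>\<alpha>\<rangle> \<chi>)"
  using assms by (meson rc_conjI rc_cut rc_polytrans)

lemma worm_append_left: "worm (xs @ zs) \<turnstile> worm xs"
  by (induction xs) (auto intro: rc_top rc_nec)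

lemma worm_append_right: "\<forall>\<alpha>\<in>set xs. \<mu> \<le> \<alpha> \<Longrightarrow> worm (xs @ \<mu> # zs) \<turnstile> \<langle>\<mu>\<rangle> worm zs"
proof (induction xs)
  case (Cons \<alpha> xs)
  then have "worm (xs @ \<mu> # zs) \<turnstile> \<langle>\<mu>\<rangle> worm zs" by simp
  moreover have "\<langle>\<alpha>\<rangle> worm (xs @ \<mu> # zs) \<turnstile> \<langle>\<mu>\<rangle> worm (xs @ \<mu> # zs)"
    using Cons.prems by (intro dia_antimono[OF rc_refl]) simp
  ultimately show ?case by (simp add: dia_trans)
qed (simp add: rc_refl)

text \<open>Polytransitivity carries \<open>\<langle>\<mu>\<rangle> worm zs\<close> inwards past
  each letter above \<mu>.\<close>

lemma worm_appendI: "\<forall>\<alpha>\<in>set xs. \<mu> < \<alpha> \<Longrightarrow> worm xs \<^bold>\<and> \<langle>\<mu>\<rangle> worm zs \<turnstile> worm (xs @ \<mu> # zs)"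
proof (induction xs)
  case (Cons \<alpha> xs)
  then have "worm xs \<^bold>\<and> \<langle>\<mu>\<rangle> worm zs \<turnstile> worm (xs @ \<mu> # zs)" by simp
  moreover have "\<langle>\<alpha>\<rangle> worm xs \<^bold>\<and> \<langle>\<mu>\<rangle> worm zs \<turnstile> \<langle>\<alpha>\<rangle> (worm xs \<^bold>\<and> \<langle>\<mu>\<rangle> worm zs)"
    using Cons.prems by (intro rc_polytrans) simp
  ultimately show ?case by (simp add: dia_cut)
qed (simp add: rc_conj2)

text \<open>Up to equivalence such a worm is the conjunction of its two parts, which reduces
  comparisons of worms to comparisons of parts.\<close>

lemma rc_worm_append_iff:
  assumes "\<forall>\<alpha>\<in>set xs. \<mu> < \<alpha>"
  shows "\<phi> \<turnstile> worm (xs @ \<mu> # zs) \<longleftrightarrow> \<phi> \<turnstile> worm xs \<and> \<phi> \<turnstile> \<langle>\<mu>\<rangle> worm zs"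
proof
  assume \<phi>: "\<phi> \<turnstile> worm (xs @ \<mu> # zs)"
  have "worm (xs @ \<mu> # zs) \<turnstile> \<langle>\<mu>\<rangle> worm zs"
    using assms by (intro worm_append_right) (simp add: less_imp_le)
  then show "\<phi> \<turnstile> worm xs \<and> \<phi> \<turnstile> \<langle>\<mu>\<rangle> worm zs"
    using \<phi> rc_cut worm_append_left by blast
next
  assume "\<phi> \<turnstile> worm xs \<and> \<phi> \<turnstile> \<langle>\<mu>\<rangle> worm zs"
  then show "\<phi> \<turnstile> worm (xs @ \<mu> # zs)"
    using rc_cut[OF rc_conjI worm_appendI[OF assms]] by blast
qed

lemma rc_dia_worm_appendI:
  assumes "\<forall>\<alpha>\<in>set xs. \<mu> < \<alpha>" "\<phi> \<turnstile> \<langle>\<nu>\<rangle> worm xs" "\<phi> \<turnstile> \<langle>\<mu>\<rangle> worm zs" "\<mu> < \<nu>"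
  shows "\<phi> \<turnstile> \<langle>\<nu>\<rangle> worm (xs @ \<mu> # zs)"
  using dia_cut[OF dia_conjI worm_appendI] assms by blast

section \<open>Splitting and linearity\<close>

lemma worm_dia_Top:
  assumes "xs \<noteq> []" "\<forall>\<alpha>\<in>set xs. \<xi> \<le> \<alpha>"
  shows "worm xs \<turnstile> \<langle>\<xi>\<rangle> \<top>"
  using assms dia_antimono[OF dia_cut[OF rc_refl rc_top]] by (cases xs) auto

text \<open>
  A nonempty word without the letter \<open>\<mu>\<close> is treated as if \<open>\<mu>\<close> were appended to it, which
  gives an equivalent worm.
\<close>

lemma worm_split:
  assumes "xs \<noteq> []" "\<forall>\<alpha>\<in>set xs. \<mu> \<le> \<alpha>"
  obtains ys zs where "\<forall>\<alpha>\<in>set ys. \<mu> < \<alpha>" "\<forall>\<alpha>\<in>set zs. \<mu> \<le> \<alpha>"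
    "worm xs \<turnstile> worm (ys @ \<mu> # zs)" "worm (ys @ \<mu> # zs) \<turnstile> worm xs"
    "length zs < length xs" "length ys \<le> length xs"
    "xs = ys @ \<mu> # zs \<or> \<mu> \<notin> set xs \<and> xs = ys \<and> zs = []"
proof (cases "\<mu> \<in> set xs")
  case True
  then obtain ys zs where xs: "xs = ys @ \<mu> # zs" "\<mu> \<notin> set ys" by (meson split_list_first)
  then have "\<forall>\<alpha>\<in>set ys. \<mu> < \<alpha>"
    using assms(2) by (auto simp: order_le_less)
  then show thesis using that[of ys zs] xs assms(2) by (simp add: rc_refl)
next
  case False
  then have less: "\<forall>\<alpha>\<in>set xs. \<mu> < \<alpha>" using assms(2) by (auto simp: order_le_less)
  have "worm xs \<turnstile> worm (xs @ \<mu> # [])"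
    unfolding rc_worm_append_iff[OF less]
    using assms worm_dia_Top[of xs \<mu>] by (simp add: rc_refl)
  then show thesis
    using that[of xs "[]"] less assms(1) worm_append_left[of xs "[\<mu>]"] False by simp
qed

text \<open>Both words are split at their common least letter \<mu>. If a tail already dominates the
  other whole word, that settles it. Otherwise each word dominates the other's tail, and the front
  parts, compared one level higher, decide.\<close>

lemma worm_linear:
  assumes "\<forall>\<alpha>\<in>set xs \<union> set ys. \<xi> \<le> \<alpha>"
  shows "worm ys \<turnstile> \<langle>\<xi>\<rangle> worm xs \<or> worm xs \<turnstile> \<langle>\<xi>\<rangle> worm ys \<or> worm xs \<turnstile> worm ys \<and> worm ys \<turnstile> worm xs"
  using assms
proof (induction "length xs + length ys" arbitrary: xs ys \<xi> rule: less_induct)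
  case less
  consider "xs = []" "ys = []" | "xs = []" "ys \<noteq> []" | "xs \<noteq> []" "ys = []"
    | "xs \<noteq> []" "ys \<noteq> []" by blast
  then show ?case
  proof cases
    case 4
    define \<mu> where "\<mu> = Min (set xs \<union> set ys)"
    have \<mu>: "\<mu> \<in> set xs \<union> set ys" "\<forall>\<alpha>\<in>set xs \<union> set ys. \<mu> \<le> \<alpha>"
      unfolding \<mu>_def using 4 Min_in[of "set xs \<union> set ys"] by auto
    then have "\<xi> \<le> \<mu>" using less.prems by blast
    obtain x1 x2 where x: "\<forall>\<alpha>\<in>set x1. \<mu> < \<alpha>" "\<forall>\<alpha>\<in>set x2. \<mu> \<le> \<alpha>"
      "worm xs \<turnstile> worm (x1 @ \<mu> # x2)" "worm (x1 @ \<mu> # x2) \<turnstile> worm xs"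
      "length x2 < length xs" "length x1 \<le> length xs"
      "xs = x1 @ \<mu> # x2 \<or> \<mu> \<notin> set xs \<and> xs = x1 \<and> x2 = []"
      using worm_split[of xs \<mu>] 4 \<mu> by blast
    obtain y1 y2 where y: "\<forall>\<alpha>\<in>set y1. \<mu> < \<alpha>" "\<forall>\<alpha>\<in>set y2. \<mu> \<le> \<alpha>"
      "worm ys \<turnstile> worm (y1 @ \<mu> # y2)" "worm (y1 @ \<mu> # y2) \<turnstile> worm ys"
      "length y2 < length ys" "length y1 \<le> length ys"
      "ys = y1 @ \<mu> # y2 \<or> \<mu> \<notin> set ys \<and> ys = y1 \<and> y2 = []"
      using worm_split[of ys \<mu>] 4 \<mu> by blast
    have X: "worm xs \<turnstile> worm x1" "worm xs \<turnstile> \<langle>\<mu>\<rangle> worm x2"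
      and Y: "worm ys \<turnstile> worm y1" "worm ys \<turnstile> \<langle>\<mu>\<rangle> worm y2"
      using x(3) y(3) unfolding rc_worm_append_iff[OF x(1)] rc_worm_append_iff[OF y(1)] by blast+
    have "worm ys \<turnstile> \<langle>\<mu>\<rangle> worm xs \<or> worm xs \<turnstile> \<langle>\<mu>\<rangle> worm ys \<or> worm xs \<turnstile> worm ys \<and> worm ys \<turnstile> worm xs"
    proof (cases "(worm y2 \<turnstile> \<langle>\<mu>\<rangle> worm xs \<or> worm y2 \<turnstile> worm xs) \<or> (worm x2 \<turnstile> \<langle>\<mu>\<rangle> worm ys \<or> worm x2 \<turnstile> worm ys)")
      case True
      then show ?thesis using dia_trans dia_cut X(2) Y(2) by blast
    next
      case False
      have 1: "worm xs \<turnstile> \<langle>\<mu>\<rangle> worm y2" "worm ys \<turnstile> \<langle>\<mu>\<rangle> worm x2"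
        using less.hyps[of xs y2 \<mu>] less.hyps[of x2 ys \<mu>] False \<mu> x(2,5) y(2,5) by auto
      \<comment> \<open>At least one word contains \<mu>, so at least one front part is properly
        shorter.\<close>
      have "length x1 + length y1 < length xs + length ys"
        using \<mu>(1) x(6,7) y(6,7) by auto
      moreover have "\<forall>\<alpha>\<in>set x1 \<union> set y1. osuc \<mu> \<le> \<alpha>"
        using x(1) y(1) by (auto simp: osuc_le_iff)
      ultimately consider "worm y1 \<turnstile> \<langle>osuc \<mu>\<rangle> worm x1" | "worm x1 \<turnstile> \<langle>osuc \<mu>\<rangle> worm y1"
        | "worm x1 \<turnstile> worm y1 \<and> worm y1 \<turnstile> worm x1"
        using less.hyps[of x1 y1 "osuc \<mu>"] by blast
      then show ?thesis
      proof cases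
        case 1
        have "worm ys \<turnstile> \<langle>osuc \<mu>\<rangle> worm (x1 @ \<mu> # x2)"
          using rc_dia_worm_appendI[OF x(1) rc_cut[OF Y(1) 1]] \<open>worm ys \<turnstile> \<langle>\<mu>\<rangle> worm x2\<close> by simp
        then show ?thesis
          using dia_antimono[of _ "osuc \<mu>" _ \<mu>] dia_cut[OF _ x(4)] by (simp add: less_imp_le)
      next
        case 2
        have "worm xs \<turnstile> \<langle>osuc \<mu>\<rangle> worm (y1 @ \<mu> # y2)"
          using rc_dia_worm_appendI[OF y(1) rc_cut[OF X(1) 2]] \<open>worm xs \<turnstile> \<langle>\<mu>\<rangle> worm y2\<close> by simp
        then show ?thesis
          using dia_antimono[of _ "osuc \<mu>" _ \<mu>] dia_cut[OF _ y(4)] by (simp add: less_imp_le)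
      next
        case 3
        have "worm xs \<turnstile> worm (y1 @ \<mu> # y2)" "worm ys \<turnstile> worm (x1 @ \<mu> # x2)"
          unfolding rc_worm_append_iff[OF x(1)] rc_worm_append_iff[OF y(1)]
          using 1 3 X(1) Y(1) rc_cut by blast+
        then show ?thesis using rc_cut x(4) y(4) by blast
      qed
    qed
    then show ?thesis using dia_antimono \<open>\<xi> \<le> \<mu>\<close> by blast
  qed (use less.prems worm_dia_Top[of ys \<xi>] worm_dia_Top[of xs \<xi>] in \<open>auto simp: rc_refl\<close>)
qed

text \<open>The two other outcomes of linearity at \<mu> would combine with the hypothesis to
  violate irreflexivity.\<close>

lemma worm_less_level:
  assumes "\<forall>\<alpha>\<in>set xs \<union> set ys. \<mu> \<le> \<alpha>" "worm xs \<turnstile> \<langle>\<xi>\<rangle> worm ys" "\<xi> \<le> \<mu>"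
  shows "worm xs \<turnstile> \<langle>\<mu>\<rangle> worm ys"
  using worm_linear[OF assms(1)]
proof (elim disjE conjE)
  assume "worm ys \<turnstile> \<langle>\<mu>\<rangle> worm xs"
  then show ?thesis
    using dia_trans[OF assms(2) dia_antimono[OF _ assms(3)]] not_worm_less_self by blast
next
  assume "worm ys \<turnstile> worm xs"
  then show ?thesis using dia_cut[OF assms(2)] not_worm_less_self by blast
qed

text \<open>The comparison step of a recursive path order. If all alternatives fail, linearity makes
  the second worm prove the first, or the first under a modality, against irreflexivity.\<close>

lemma worm_less_append_cases:
  assumes x: "\<forall>\<alpha>\<in>set x1. \<mu> < \<alpha>" "\<forall>\<alpha>\<in>set x2. \<mu> \<le> \<alpha>"
    and y: "\<forall>\<alpha>\<in>set y1. \<mu> < \<alpha>" "\<forall>\<alpha>\<in>set y2. \<mu> \<le> \<alpha>"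
    and less: "worm (x1 @ \<mu> # x2) \<turnstile> \<langle>\<mu>\<rangle> worm (y1 @ \<mu> # y2)"
  shows "worm x2 \<turnstile> worm (y1 @ \<mu> # y2) \<or> worm x2 \<turnstile> \<langle>\<mu>\<rangle> worm (y1 @ \<mu> # y2) \<or>
    worm x1 \<turnstile> \<langle>osuc \<mu>\<rangle> worm y1"
proof (rule ccontr)
  let ?X = "x1 @ \<mu> # x2" and ?Y = "y1 @ \<mu> # y2"
  assume not: "\<not> ?thesis"
  have "\<forall>\<alpha>\<in>set x2 \<union> set ?Y. \<mu> \<le> \<alpha>" using x y by (auto simp: less_imp_le)
  then have Y2: "worm ?Y \<turnstile> \<langle>\<mu>\<rangle> worm x2"
    using worm_linear not by blast
  have Y1: "worm ?Y \<turnstile> worm y1" by (rule worm_append_left)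
  have "\<forall>\<alpha>\<in>set x1 \<union> set y1. osuc \<mu> \<le> \<alpha>"
    using x(1) y(1) by (auto simp: osuc_le_iff)
  then consider "worm y1 \<turnstile> \<langle>osuc \<mu>\<rangle> worm x1" | "worm y1 \<turnstile> worm x1"
    using worm_linear not by blast
  then show False
  proof cases
    case 1
    have "worm ?Y \<turnstile> \<langle>osuc \<mu>\<rangle> worm ?X"
      using rc_dia_worm_appendI[OF x(1) rc_cut[OF Y1 1] Y2] by simp
    then have "worm ?X \<turnstile> \<langle>\<mu>\<rangle> worm ?X"
      using dia_trans[OF less] dia_antimono less_osuc less_imp_le by blast
    then show False using not_worm_less_self by blast
  next
    case 2
    have "worm ?Y \<turnstile> worm ?X"
      unfolding rc_worm_append_iff[OF x(1)] using rc_cut[OF Y1 2] Y2 by blast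
    then show False using dia_cut[OF less] not_worm_less_self by blast
  qed
qed

section \<open>The letters that matter at a given level\<close>

abbreviation head :: "'a ordinal \<Rightarrow> 'a ordinal list \<Rightarrow> 'a ordinal list"
  where "head \<xi> \<equiv> takeWhile (\<lambda>\<alpha>. \<xi> \<le> \<alpha>)"

lemma head_ge: "\<alpha> \<in> set (head \<xi> xs) \<Longrightarrow> \<xi> \<le> \<alpha>"
  by (rule set_takeWhileD[THEN conjunct2])

lemma worm_head: "worm xs \<turnstile> worm (head \<xi> xs)"
  using worm_append_left[of "head \<xi> xs" "dropWhile (\<lambda>\<alpha>. \<xi> \<le> \<alpha>) xs"] by simp

text \<open>Otherwise the rest of the word, whose first letter is below \<xi>, could be put back
  behind the head inside \<open>\<langle>\<xi>\<rangle>\<close>, against irreflexivity.\<close>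

lemma not_worm_less_head: "\<not> worm xs \<turnstile> \<langle>\<xi>\<rangle> worm (head \<xi> xs)"
proof
  assume less: "worm xs \<turnstile> \<langle>\<xi>\<rangle> worm (head \<xi> xs)"
  show False
  proof (cases "dropWhile (\<lambda>\<alpha>. \<xi> \<le> \<alpha>) xs")
    case Nil
    then have "head \<xi> xs = xs" by (metis append_Nil2 takeWhile_dropWhile_id)
    then show False using less not_worm_less_self by metis
  next
    case (Cons \<mu> zs)
    then have xs: "xs = head \<xi> xs @ \<mu> # zs" by (metis takeWhile_dropWhile_id)
    have "\<mu> < \<xi>" using Cons by (metis hd_dropWhile list.distinct(1) list.sel(1) not_le)
    then have gt: "\<forall>\<alpha>\<in>set (head \<xi> xs). \<mu> < \<alpha>" using head_ge less_le_trans by blast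
    have "worm xs \<turnstile> \<langle>\<mu>\<rangle> worm zs"
      using worm_append_right[of "head \<xi> xs" \<mu> zs] gt xs by (simp add: less_imp_le)
    then have "worm xs \<turnstile> \<langle>\<xi>\<rangle> worm xs"
      using rc_dia_worm_appendI[OF gt less _ \<open>\<mu> < \<xi>\<close>] xs by metis
    then show False using not_worm_less_self by blast
  qed
qed

text \<open>By linearity of the two heads: either other outcome would put the head of
  \<open>xs\<close> below \<open>xs\<close>, against \<open>not_worm_less_head\<close>.\<close>

lemma worm_less_head:
  assumes "worm xs \<turnstile> \<langle>\<xi>\<rangle> worm ys"
  shows "worm (head \<xi> xs) \<turnstile> \<langle>\<xi>\<rangle> worm (head \<xi> ys)"
proof -
  have less: "worm xs \<turnstile> \<langle>\<xi>\<rangle> worm (head \<xi> ys)"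
    by (rule dia_cut[OF assms worm_head])
  have "\<forall>\<alpha>\<in>set (head \<xi> ys) \<union> set (head \<xi> xs). \<xi> \<le> \<alpha>" using head_ge by blast
  from worm_linear[OF this] show ?thesis
    using dia_trans[OF less] dia_cut[OF less] not_worm_less_head by blast
qed

section \<open>Well-foundedness\<close>

text \<open>Level 0 suffices, since \<open>\<langle>\<xi>\<rangle> \<phi>\<close> proves
  \<open>\<langle>0\<rangle> \<phi>\<close>. Pointwise accessibility allows induction on it for the
  front part of a word.\<close>

abbreviation worm_acc :: "'a ordinal list \<Rightarrow> bool"
  where "worm_acc \<equiv> Wellfounded.accp (\<lambda>ys xs. worm xs \<turnstile> \<langle>0\<rangle> worm ys)"

lemma worm_acc_mono:
  assumes "worm_acc xs" "worm xs \<turnstile> worm ys"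
  shows "worm_acc ys"
proof (rule accp.accI)
  fix zs
  assume "worm ys \<turnstile> \<langle>0\<rangle> worm zs"
  then show "worm_acc zs"
    using accp_downward[OF assms(1)] rc_cut[OF assms(2)] by blast
qed

lemma not_worm_less_Nil: "\<not> worm [] \<turnstile> \<langle>\<xi>\<rangle> worm ys"
proof
  assume "worm [] \<turnstile> \<langle>\<xi>\<rangle> worm ys"
  then have "worm [] \<turnstile> \<langle>\<xi>\<rangle> worm []"
    by (rule dia_cut) (simp add: rc_top)
  then show False using not_worm_less_self by blast
qed

lemma worm_acc_Nil: "worm_acc []"
  by (rule accp.accI) (use not_worm_less_Nil in blast)

text \<open>
  As for recursive path orders: by \<open>worm_less_append_cases\<close>, a worm below \<open>xs @ \<mu> # zs\<close> is
  below or equivalent to \<open>zs\<close>, or has pieces below \<open>xs\<close> and below \<open>xs @ \<mu> # zs\<close>, or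
  has a letter smaller than \<open>\<mu>\<close>.
\<close>

lemma worm_acc_append:
  "worm_acc xs \<Longrightarrow> worm_acc zs \<Longrightarrow> \<forall>\<alpha>\<in>set xs. \<mu> < \<alpha> \<Longrightarrow> \<forall>\<alpha>\<in>set zs. \<mu> \<le> \<alpha> \<Longrightarrow>
    worm_acc (xs @ \<mu> # zs)"
\<comment> \<open>Three nested inductions: on the letter \<mu>, on the accessibility of
  \<open>xs\<close>, and below on the length of \<open>ys\<close>.\<close>
proof (induction \<mu> arbitrary: xs zs rule: less_induct)
  case (less \<mu>)
  note outer_IH = less.IH
  from less.prems show ?case
  proof (induction xs arbitrary: zs rule: accp_induct_rule)
    case (1 xs)
    let ?X = "xs @ \<mu> # zs"
    have X: "\<forall>\<alpha>\<in>set ?X. \<mu> \<le> \<alpha>" using 1 by (auto simp: less_imp_le)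
    have "worm_acc ys" if "worm ?X \<turnstile> \<langle>0\<rangle> worm ys" for ys
      using that
    proof (induction "length ys" arbitrary: ys rule: less_induct)
      case less
      show ?case
      proof (cases "ys = []")
        case True
        then show ?thesis using worm_acc_Nil by simp
      next
        case False
        define \<nu> where "\<nu> = Min (set ys)"
        have \<nu>: "\<nu> \<in> set ys" "\<forall>\<alpha>\<in>set ys. \<nu> \<le> \<alpha>"
          unfolding \<nu>_def using False Min_in[of "set ys"] by auto
        show ?thesis
        proof (cases "\<nu> < \<mu>")
          case True
          \<comment> \<open>Both pieces are shorter and below \<open>?X\<close>, hence accessible,
            and the outer hypothesis at \<open>\<nu> < \<mu>\<close> joins them.\<close>
          obtain y1 y2 where y: "\<forall>\<alpha>\<in>set y1. \<nu> < \<alpha>" "\<forall>\<alpha>\<in>set y2. \<nu> \<le> \<alpha>" "ys = y1 @ \<nu> # y2"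
            using worm_split[OF False \<nu>(2)] \<nu>(1) by metis
          have "worm ?X \<turnstile> \<langle>0\<rangle> worm y1" "worm ?X \<turnstile> \<langle>0\<rangle> \<langle>\<nu>\<rangle> worm y2"
            using dia_cut[OF less.prems] rc_worm_append_iff[OF y(1), of "worm ys"] y(3) rc_refl by auto
          then have "worm ?X \<turnstile> \<langle>0\<rangle> worm y1" "worm ?X \<turnstile> \<langle>0\<rangle> worm y2"
            using dia_trans[OF _ dia_antimono[OF rc_refl zero_le_ordinal]] by blast+
          then have "worm_acc y1" "worm_acc y2"
            using less.hyps y(3) by auto
          then show ?thesis
            using outer_IH[OF True] y by blast
        next
          case False
          then have ge: "\<forall>\<alpha>\<in>set ys. \<mu> \<le> \<alpha>" using \<nu>(2) by auto
          obtain y1 y2 where y: "\<forall>\<alpha>\<in>set y1. \<mu> < \<alpha>" "\<forall>\<alpha>\<in>set y2. \<mu> \<le> \<alpha>"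
            "worm ys \<turnstile> worm (y1 @ \<mu> # y2)" "worm (y1 @ \<mu> # y2) \<turnstile> worm ys" "length y2 < length ys"
            "ys = y1 @ \<mu> # y2 \<or> \<mu> \<notin> set ys \<and> ys = y1 \<and> y2 = []"
            using worm_split[OF \<open>ys \<noteq> []\<close> ge] by metis
          have less_\<mu>: "worm ?X \<turnstile> \<langle>\<mu>\<rangle> worm (y1 @ \<mu> # y2)"
            by (rule dia_cut[OF worm_less_level[OF _ less.prems] y(3)]) (use X ge in auto)
          from worm_less_append_cases[OF 1(4,5) y(1,2) less_\<mu>]
          show ?thesis
          proof (elim disjE)
            assume "worm zs \<turnstile> worm (y1 @ \<mu> # y2)"
            then show ?thesis using worm_acc_mono[OF 1(3)] rc_cut y(4) by blast
          next
            assume "worm zs \<turnstile> \<langle>\<mu>\<rangle> worm (y1 @ \<mu> # y2)"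
            then have "worm zs \<turnstile> \<langle>0\<rangle> worm ys"
              using dia_antimono dia_cut y(4) zero_le_ordinal by blast
            then show ?thesis using accp_downward[OF 1(3)] by blast
          next
            assume "worm xs \<turnstile> \<langle>osuc \<mu>\<rangle> worm y1"
            then have y1: "worm xs \<turnstile> \<langle>0\<rangle> worm y1"
              using dia_antimono zero_le_ordinal by blast
            have "worm ?X \<turnstile> \<langle>\<mu>\<rangle> \<langle>\<mu>\<rangle> worm y2"
              using dia_cut[OF less_\<mu>] rc_worm_append_iff[OF y(1)] rc_refl by blast
            then have "worm ?X \<turnstile> \<langle>0\<rangle> worm y2"
              using dia_antimono[OF rc_cut[OF _ rc_trans4]] zero_le_ordinal by blast
            then have "worm_acc y2" using less.hyps y(5) by blast
            \<comment> \<open>The tail is arbitrary in the induction on accessibility, so it applies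
              to \<open>y1\<close> with the accessible tail \<open>y2\<close>.\<close>
            then have "worm_acc (y1 @ \<mu> # y2)"
              using 1(2)[OF y1] y(1,2) by blast
            then show ?thesis using worm_acc_mono y(4) by blast
          qed
        qed
      qed
    qed
    then show ?case by (rule accp.accI)
  qed
qed

lemma worm_acc: "worm_acc xs"
proof (induction "length xs" arbitrary: xs rule: less_induct)
  case less
  show ?case
  proof (cases "xs = []")
    case True
    then show ?thesis using worm_acc_Nil by simp
  next
    case False
    define \<mu> where "\<mu> = Min (set xs)"
    have \<mu>: "\<mu> \<in> set xs" "\<forall>\<alpha>\<in>set xs. \<mu> \<le> \<alpha>"
      unfolding \<mu>_def using False Min_in[of "set xs"] by auto
    obtain x1 x2 where x: "\<forall>\<alpha>\<in>set x1. \<mu> < \<alpha>" "\<forall>\<alpha>\<in>set x2. \<mu> \<le> \<alpha>" "xs = x1 @ \<mu> # x2"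
      using worm_split[OF False \<mu>(2)] \<mu>(1) by metis
    then have "worm_acc x1" "worm_acc x2" using less by simp_all
    then show ?thesis using worm_acc_append x by blast
  qed
qed

text \<open>Defined on all formulas because derivations between worms may pass through conjunctions;
  on worms it inverts \<open>worm\<close>.\<close>

primrec letters :: "'a formula \<Rightarrow> 'a ordinal list"
  where
    "letters \<top> = []"
  | "letters (\<phi> \<^bold>\<and> \<psi>) = letters \<phi> @ letters \<psi>"
  | "letters (\<langle>\<alpha>\<rangle> \<phi>) = \<alpha> # letters \<phi>"

lemma letters_worm [simp]: "letters (worm xs) = xs"
  by (induction xs) simp_all

lemma wf_worm_less: "wf {(B, A). B \<in> worms \<and> A \<in> worms \<and> worm_less \<xi> B A}"
proof -
  have "wf {(ys, xs). worm xs \<turnstile> \<langle>0\<rangle> worm ys}"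
    unfolding wfp_def[symmetric] by (rule accp_wfpI) (use worm_acc in blast)
  then show ?thesis
  proof (rule wf_subset[OF wf_inv_image[where f = letters]])
    show "{(B, A). B \<in> worms \<and> A \<in> worms \<and> worm_less \<xi> B A} \<subseteq>
        inv_image {(ys, xs). worm xs \<turnstile> \<langle>0\<rangle> worm ys} letters"
      using dia_antimono[OF _ zero_le_ordinal] by (auto simp: worm_less_def worms_eq_range)
  qed
qed

section \<open>The order types\<close>

text \<open>Only \<open>rc_mono\<close> brings in a new letter, and that one is smaller than a
  letter present. So the worms below a given one are words over a bounded alphabet, few enough for
  \<open>osup\<close>.\<close>

lemma letters_bounded: "\<phi> \<turnstile> \<psi> \<Longrightarrow> set (letters \<phi>) \<subseteq> {..u} \<Longrightarrow> set (letters \<psi>) \<subseteq> {..u}"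
  by (induction rule: rc.induct) auto

lemma card_of_lists_le: "(card_of {xs. set xs \<subseteq> {..u :: 'a ordinal}}, card_of (UNIV :: ('a + nat) set)) \<in> ordLeq"
proof -
  have le: "(card_of {..u}, card_of (UNIV :: ('a + nat) set)) \<in> ordLeq"
    using card_lessThan_ordinal[of "osuc u"] by (simp add: less_osuc_iff lessThan_def atMost_def)
  have "(card_of {xs. set xs \<subseteq> {..u} \<and> length xs = n}, card_of (UNIV :: ('a + nat) set)) \<in> ordLeq" for n
  proof (induction n)
    case 0
    have "{xs. set xs \<subseteq> {..u} \<and> length xs = 0} = {[]}" by auto
    then show ?case by (simp add: card_of_singl_ordLeq)
  next
    case (Suc n)
    have "{xs. set xs \<subseteq> {..u} \<and> length xs = Suc n} =
        (\<Union>\<alpha>\<in>{..u}. (#) \<alpha> ` {xs. set xs \<subseteq> {..u} \<and> length xs = n})"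
      by (auto simp: length_Suc_conv)
    moreover have "(card_of (\<Union>\<alpha>\<in>{..u}. (#) \<alpha> ` {xs. set xs \<subseteq> {..u} \<and> length xs = n}),
        card_of (UNIV :: ('a + nat) set)) \<in> ordLeq"
      by (intro card_of_UNION_ordLeq_infinite[OF infinite_plus_nat le] ballI
          ordLeq_transitive[OF card_of_image Suc])
    ultimately show ?case by simp
  qed
  then have "(card_of (\<Union>n. {xs. set xs \<subseteq> {..u} \<and> length xs = n}), card_of (UNIV :: ('a + nat) set)) \<in> ordLeq"
    by (intro card_of_UNION_ordLeq_infinite[OF infinite_plus_nat nat_ordLeq_plus_nat] ballI)
  moreover have "{xs. set xs \<subseteq> {..u}} = (\<Union>n. {xs. set xs \<subseteq> {..u} \<and> length xs = n})" by auto
  ultimately show ?thesis by simp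
qed

lemma bdd_above_worm_less_image:
  "bdd_above {f B | B. B \<in> worms \<and> worm_less \<xi> B A}" for f :: "'a formula \<Rightarrow> 'a ordinal"
proof -
  have "\<exists>u. set xs \<subseteq> {..u}" for xs :: "'a ordinal list"
    by (cases "xs = []") (auto intro!: exI[of _ "Max (set xs)"])
  then obtain u where u: "set (letters A) \<subseteq> {..u}" by blast
  have "{f B | B. B \<in> worms \<and> worm_less \<xi> B A} \<subseteq> (f \<circ> worm) ` {xs. set xs \<subseteq> {..u}}"
  proof clarify
    fix B
    assume "B \<in> worms" "worm_less \<xi> B A"
    then obtain ys where ys: "B = worm ys" by (auto simp: worms_eq_range)
    have "set (letters (\<langle>\<xi>\<rangle> B)) \<subseteq> {..u}"
      using \<open>worm_less \<xi> B A\<close> letters_bounded[OF _ u] unfolding worm_less_def by blast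
    then show "f B \<in> (f \<circ> worm) ` {xs. set xs \<subseteq> {..u}}" using ys by auto
  qed
  then have "(card_of {f B | B. B \<in> worms \<and> worm_less \<xi> B A}, card_of (UNIV :: ('a + nat) set)) \<in> ordLeq"
    by (rule ordLeq_transitive[OF card_of_mono1 ordLeq_transitive[OF card_of_image card_of_lists_le]])
  then show ?thesis by (rule bdd_above_small)
qed

lemma worm_o_rec:
  assumes "A \<in> worms"
  shows "worm_o \<xi> A = osup {worm_o \<xi> B + 1 | B. B \<in> worms \<and> worm_less \<xi> B A}"
proof -
  let ?R = "{(B, A). B \<in> worms \<and> A \<in> worms \<and> worm_less \<xi> B A}"
  have "worm_o \<xi> A = osup {cut (worm_o \<xi>) ?R A B + 1 | B. B \<in> worms \<and> worm_less \<xi> B A}"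
    unfolding worm_o_def by (subst wfrec[OF wf_worm_less]) (rule refl)
  also have "{cut (worm_o \<xi>) ?R A B + 1 | B. B \<in> worms \<and> worm_less \<xi> B A} =
      {worm_o \<xi> B + 1 | B. B \<in> worms \<and> worm_less \<xi> B A}"
    using assms by (intro Collect_cong ex_cong1) (auto simp: cut_def)
  finally show ?thesis .
qed

section \<open>Values of the order types\<close>

abbreviation order_type :: "'a ordinal \<Rightarrow> 'a ordinal list \<Rightarrow> 'a ordinal"
  where "order_type \<xi> xs \<equiv> worm_o \<xi> (worm xs)"

lemma less_order_type_iff:
  "c < order_type \<xi> xs \<longleftrightarrow> (\<exists>ys. worm xs \<turnstile> \<langle>\<xi>\<rangle> worm ys \<and> c \<le> order_type \<xi> ys)"
proof -
  have "c < order_type \<xi> xs \<longleftrightarrow> (\<exists>B\<in>worms. worm_less \<xi> B (worm xs) \<and> c < worm_o \<xi> B + 1)"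
    by (subst worm_o_rec) (auto simp: less_osup_iff bdd_above_worm_less_image)
  then show ?thesis
    by (simp add: worms_eq_range worm_less_def less_plus_one_ordinal_iff)
qed

lemma order_type_less: "worm xs \<turnstile> \<langle>\<xi>\<rangle> worm ys \<Longrightarrow> order_type \<xi> ys < order_type \<xi> xs"
  using less_order_type_iff by blast

lemma order_type_mono:
  assumes "worm xs \<turnstile> worm ys"
  shows "order_type \<xi> ys \<le> order_type \<xi> xs"
proof (rule le_if_less_imp_less)
  fix c
  assume "c < order_type \<xi> ys"
  then show "c < order_type \<xi> xs"
    unfolding less_order_type_iff using rc_cut[OF assms] by blast
qed

text \<open>If the head had a smaller order type, some \<open>ys\<close> below \<open>xs\<close>
  would reach at least that value; but the head of \<open>ys\<close> is below the head of
  \<open>xs\<close> and, by induction, has the order type of \<open>ys\<close>.\<close>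

lemma order_type_head: "order_type \<xi> (head \<xi> xs) = order_type \<xi> xs"
proof (induction "order_type \<xi> xs" arbitrary: xs rule: less_induct)
  case less
  show ?case
  proof (rule antisym)
    show "order_type \<xi> (head \<xi> xs) \<le> order_type \<xi> xs"
      by (rule order_type_mono[OF worm_head])
    show "order_type \<xi> xs \<le> order_type \<xi> (head \<xi> xs)"
    proof (rule ccontr)
      assume "\<not> ?thesis"
      then have "order_type \<xi> (head \<xi> xs) < order_type \<xi> xs" by simp
      then obtain ys where ys: "worm xs \<turnstile> \<langle>\<xi>\<rangle> worm ys" "order_type \<xi> (head \<xi> xs) \<le> order_type \<xi> ys"
        unfolding less_order_type_iff[of _ \<xi> xs] by blast
      have "order_type \<xi> (head \<xi> ys) < order_type \<xi> (head \<xi> xs)"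
        by (rule order_type_less[OF worm_less_head[OF ys(1)]])
      then show False
        using less.hyps[OF order_type_less[OF ys(1)]] ys(2) by simp
    qed
  qed
qed

lemma less_order_typeE:
  assumes "c < order_type \<xi> xs"
  obtains ys where "worm xs \<turnstile> \<langle>\<xi>\<rangle> worm ys" "c \<le> order_type \<xi> ys" "\<forall>\<alpha>\<in>set ys. \<xi> \<le> \<alpha>"
proof -
  obtain ys where ys: "worm xs \<turnstile> \<langle>\<xi>\<rangle> worm ys" "c \<le> order_type \<xi> ys"
    using assms less_order_type_iff by blast
  show thesis
  proof (rule that)
    show "worm xs \<turnstile> \<langle>\<xi>\<rangle> worm (head \<xi> ys)" by (rule dia_cut[OF ys(1) worm_head])
    show "c \<le> order_type \<xi> (head \<xi> ys)" by (simp add: order_type_head ys(2))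
    show "\<forall>\<alpha>\<in>set (head \<xi> ys). \<xi> \<le> \<alpha>" using head_ge by blast
  qed
qed

lemma order_type_Nil: "order_type \<xi> [] = 0"
proof (rule ccontr)
  assume "order_type \<xi> [] \<noteq> 0"
  then have "0 < order_type \<xi> []" by (simp add: zero_less_iff_ordinal)
  then show False by (rule less_order_typeE) (use not_worm_less_Nil in blast)
qed

text \<open>The upper bound follows \<open>worm_less_append_cases\<close>; the lower one checks the
  closure required by \<open>add_omega_pow_le_if_closed\<close>. Induction on the value makes the
  formula available for worms below the given one.\<close>

lemma order_type_append:
  assumes "\<forall>\<alpha>\<in>set xs. \<xi> < \<alpha>" "\<forall>\<alpha>\<in>set zs. \<xi> \<le> \<alpha>"
  shows "order_type \<xi> (xs @ \<xi> # zs) = order_type \<xi> zs + \<omega>^ order_type (\<xi> + 1) xs"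
  using assms
proof (induction "order_type \<xi> (xs @ \<xi> # zs)" arbitrary: xs zs rule: less_induct)
  case less
  let ?X = "xs @ \<xi> # zs"
  have X: "worm ?X \<turnstile> worm xs" "worm ?X \<turnstile> \<langle>\<xi>\<rangle> worm zs"
    using rc_worm_append_iff[OF less.prems(1)] rc_refl by blast+
  note IH = less.hyps
  have upper: "order_type \<xi> ys < order_type \<xi> zs + \<omega>^ order_type (\<xi> + 1) xs"
    if "worm ?X \<turnstile> \<langle>\<xi>\<rangle> worm ys" "\<forall>\<alpha>\<in>set ys. \<xi> \<le> \<alpha>" for ys
    using that
  \<comment> \<open>In the last case the bound is needed first for the tail of \<open>ys\<close>, a
    shorter word that is also below \<open>?X\<close>.\<close>
  proof (induction "length ys" arbitrary: ys rule: less_induct)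
    case (less ys)
    show ?case
    proof (cases "ys = []")
      case True
      have "0 < order_type \<xi> zs + \<omega>^ order_type (\<xi> + 1) xs"
        by (rule less_le_trans[OF omega_pow_pos le_add_right_ordinal])
      then show ?thesis using True by (simp only: order_type_Nil)
    next
      case False
      obtain y1 y2 where y: "\<forall>\<alpha>\<in>set y1. \<xi> < \<alpha>" "\<forall>\<alpha>\<in>set y2. \<xi> \<le> \<alpha>"
        "worm ys \<turnstile> worm (y1 @ \<xi> # y2)" "worm (y1 @ \<xi> # y2) \<turnstile> worm ys" "length y2 < length ys"
        using worm_split[OF False less.prems(2)] by metis
      have Y: "worm ?X \<turnstile> \<langle>\<xi>\<rangle> worm (y1 @ \<xi> # y2)"
        by (rule dia_cut[OF less.prems(1) y(3)])
      have eq: "order_type \<xi> ys = order_type \<xi> y2 + \<omega>^ order_type (\<xi> + 1) y1"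
        using IH[OF order_type_less[OF Y] y(1,2)] order_type_mono[OF y(3)] order_type_mono[OF y(4)]
        by (metis antisym)
      have lt: "order_type \<xi> zs < order_type \<xi> zs + \<omega>^ order_type (\<xi> + 1) xs"
        using add_strict_left_mono_ordinal[OF omega_pow_pos] by (metis add.right_neutral)
      from worm_less_append_cases[OF \<open>\<forall>\<alpha>\<in>set xs. \<xi> < \<alpha>\<close> \<open>\<forall>\<alpha>\<in>set zs. \<xi> \<le> \<alpha>\<close> y(1,2) Y]
      show ?thesis
      proof (elim disjE)
        assume "worm zs \<turnstile> worm (y1 @ \<xi> # y2)"
        then have "order_type \<xi> ys \<le> order_type \<xi> zs"
          by (rule order_type_mono[OF rc_cut[OF _ y(4)]])
        then show ?thesis using lt by (rule le_less_trans)
      next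
        assume "worm zs \<turnstile> \<langle>\<xi>\<rangle> worm (y1 @ \<xi> # y2)"
        then have "order_type \<xi> ys < order_type \<xi> zs"
          by (rule order_type_less[OF dia_cut[OF _ y(4)]])
        then show ?thesis using lt by (rule less_trans)
      next
        assume "worm xs \<turnstile> \<langle>osuc \<xi>\<rangle> worm y1"
        then have "order_type (\<xi> + 1) y1 < order_type (\<xi> + 1) xs"
          by (simp add: order_type_less plus_one_ordinal)
        moreover have "worm (y1 @ \<xi> # y2) \<turnstile> \<langle>\<xi>\<rangle> worm y2"
          using rc_worm_append_iff[OF y(1)] rc_refl by blast
        then have "order_type \<xi> y2 < order_type \<xi> zs + \<omega>^ order_type (\<xi> + 1) xs"
          using less.hyps[OF y(5) dia_trans[OF Y]] y(2) by blast
        ultimately show ?thesis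
          unfolding eq by (intro less_add_omega_pow)
      qed
    qed
  qed
  show ?case
  proof (rule antisym)
    show "order_type \<xi> ?X \<le> order_type \<xi> zs + \<omega>^ order_type (\<xi> + 1) xs"
    proof (rule le_if_less_imp_less)
      fix c
      assume "c < order_type \<xi> ?X"
      then show "c < order_type \<xi> zs + \<omega>^ order_type (\<xi> + 1) xs"
        by (rule less_order_typeE) (rule le_less_trans[OF _ upper])
    qed
    show "order_type \<xi> zs + \<omega>^ order_type (\<xi> + 1) xs \<le> order_type \<xi> ?X"
    proof (rule add_omega_pow_le_if_closed)
      show "order_type \<xi> zs < order_type \<xi> ?X" by (rule order_type_less[OF X(2)])
      fix c d
      assume "c < order_type \<xi> ?X" "d < order_type (\<xi> + 1) xs"
      from this(1) obtain ys where ys: "worm ?X \<turnstile> \<langle>\<xi>\<rangle> worm ys" "c \<le> order_type \<xi> ys" "\<forall>\<alpha>\<in>set ys. \<xi> \<le> \<alpha>"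
        by (rule less_order_typeE)
      from \<open>d < order_type (\<xi> + 1) xs\<close> obtain ds where
        ds: "worm xs \<turnstile> \<langle>\<xi> + 1\<rangle> worm ds" "d \<le> order_type (\<xi> + 1) ds" "\<forall>\<alpha>\<in>set ds. \<xi> + 1 \<le> \<alpha>"
        by (rule less_order_typeE)
      have gt: "\<forall>\<alpha>\<in>set ds. \<xi> < \<alpha>" using ds(3) by (simp add: plus_one_le_ordinal_iff)
      have "\<xi> < \<xi> + 1" by (simp add: less_plus_one_ordinal_iff)
      \<comment> \<open>Joining the witnesses for \<open>d\<close> and \<open>c\<close> gives a worm
        still below \<open>?X\<close>; its order type, known by induction, is at least
        \<open>c + \<omega>^ d\<close>.\<close>
      then have "worm ?X \<turnstile> \<langle>\<xi> + 1\<rangle> worm (ds @ \<xi> # ys)"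
        by (rule rc_dia_worm_appendI[OF gt rc_cut[OF X(1) ds(1)] ys(1)])
      then have "worm ?X \<turnstile> \<langle>\<xi>\<rangle> worm (ds @ \<xi> # ys)"
        by (rule dia_antimono) simp
      then have "order_type \<xi> (ds @ \<xi> # ys) < order_type \<xi> ?X"
        by (rule order_type_less)
      moreover have "c + \<omega>^ d \<le> order_type \<xi> ys + \<omega>^ order_type (\<xi> + 1) ds"
        using add_right_mono_ordinal[OF ys(2)] omega_pow_mono[OF ds(2)]
        by (meson add_le_cancel_left_ordinal order_trans)
      ultimately show "c + \<omega>^ d < order_type \<xi> ?X"
        using IH[OF _ gt ys(3)] by simp
    qed
  qed
qed

theorem theorem8p4:
  fixes \<xi> :: "'a ordinal" and A :: "'a formula"
  assumes "A \<in> worms"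
  shows "worm_o (\<xi> + 1) A = \<ell> (worm_o \<xi> A)"
proof -
  obtain xs where A: "A = worm xs" using assms by (auto simp: worms_eq_range)
  \<comment> \<open>Order types at \<open>\<xi> + 1\<close> depend only on the head there, so
    passing to the head at \<xi> first changes nothing.\<close>
  have "head (\<xi> + 1) (head \<xi> xs) = head (\<xi> + 1) xs"
    by (induction xs) (auto simp: plus_one_le_ordinal_iff)
  then have eq: "order_type (\<xi> + 1) (head \<xi> xs) = order_type (\<xi> + 1) xs"
    by (metis order_type_head)
  show ?thesis
  proof (cases "head \<xi> xs = []")
    case True
    \<comment> \<open>Both order types are 0, matching the convention
      \<open>\<ell> 0 = 0\<close>.\<close>
    then show ?thesis
      using eq order_type_head[of \<xi> xs] order_type_Nil A by (metis ell_zero)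
  next
    case False
    have "\<forall>\<alpha>\<in>set (head \<xi> xs). \<xi> \<le> \<alpha>" using head_ge by blast
    then obtain ys zs where y: "\<forall>\<alpha>\<in>set ys. \<xi> < \<alpha>" "\<forall>\<alpha>\<in>set zs. \<xi> \<le> \<alpha>"
      "worm (head \<xi> xs) \<turnstile> worm (ys @ \<xi> # zs)" "worm (ys @ \<xi> # zs) \<turnstile> worm (head \<xi> xs)"
      using worm_split[OF False] by metis
    have same: "order_type \<zeta> (ys @ \<xi> # zs) = order_type \<zeta> (head \<xi> xs)" for \<zeta>
      using order_type_mono[OF y(3)] order_type_mono[OF y(4)] by (rule antisym)
    \<comment> \<open>The separator \<xi> ends the head at \<open>\<xi> + 1\<close>, so
      \<open>ys\<close> alone determines the order type there.\<close>
    have "head (\<xi> + 1) (ys @ \<xi> # zs) = ys"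
      using y(1) by (subst takeWhile_append2) (auto simp: plus_one_le_ordinal_iff)
    then have "order_type (\<xi> + 1) ys = order_type (\<xi> + 1) (head \<xi> xs)"
      using order_type_head[of "\<xi> + 1" "ys @ \<xi> # zs"] same by simp
    then show ?thesis
      using order_type_append[OF y(1,2)] same[of \<xi>] eq order_type_head[of \<xi> xs] A
      by (metis ell_add_omega_pow)
  qed
qed

end
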